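(* Let $\sigma>0$. For all $p\ge2$, the sequence $(G_N(u))_{N\ge1}$ is a Cauchy sequence in the space $L^p\big(X^0(\mathbb{S}^1),\mathcal{B},d\mu;H^{-\sigma}(\mathbb{S}^1)\big)$. Namely, for all $p\ge2$ there exist $\eta>0$ and $C>0$ such that for all $1\le M<N$, $$\int_{X^0(\mathbb{S}^1)}\|G_N(u)-G_M(u)\|^p_{H^{-\sigma}(\mathbb{S}^1)}\,d\mu(u)\le\frac{C}{M^\eta}.$$
   Context: $\mathbb{S}^1=\mathbb{R}/2\pi\mathbb{Z}$; $\|f\|_{L^2(\mathbb{S}^1)}^2=\frac1{2\pi}\int_0^{2\pi}|f|^2dx$. $X^0(\mathbb{S}^1)=\bigcap_{\sigma>0}H^{-\sigma}(\mathbb{S}^1)$ with Borel $\sigma$-algebra $\mathcal{B}$. $\Pi_N$ is the projector on Fourier modes $|n|\le N$. The measure $\mu$ is the law on $X^0(\mathbb{S}^1)$ of $\varphi(\omega,x)=\sum_{n\in\mathbb{Z}}\frac{g_n(\omega)}{(1+|n|)^{1/2}}e^{inx}$, where $(g_n)_{n\in\mathbb{Z}}$ are independent normalized complex Gaussians ($g_n=\frac1{\sqrt2}(h_n+i\ell_n)$ with $h_n,\ell_n$ independent real standard Gaussians). Finally $$G_N(u)=\Pi_N\big(|\Pi_Nu|^2\Pi_Nu\big)-2\|\Pi_Nu\|^2_{L^2(\mathbb{S}^1)}\Pi_Nu .$$ *)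

theory Defs
  imports "HOL-Probability.Probability"
begin

section \<open>Distributions on the circle\<close>

text \<open>
  Functions on \<open>\<real>/2\<pi>\<int>\<close> are \<open>2\<pi>\<close>-periodic functions on \<open>\<real>\<close>.
\<close>

definition nth_deriv :: "nat \<Rightarrow> (real \<Rightarrow> complex) \<Rightarrow> real \<Rightarrow> complex" where
  "nth_deriv k f = ((\<lambda>h x. vector_derivative h (at x)) ^^ k) f"

definition test_functions :: "(real \<Rightarrow> complex) set" where
  "test_functions =
     {\<psi>. (\<forall>x. \<psi> (x + 2 * pi) = \<psi> x) \<and> (\<forall>k x. nth_deriv k \<psi> differentiable (at x))}"

type_synonym functional = "(real \<Rightarrow> complex) \<Rightarrow> complex"

text \<open>
  A distribution is a continuous linear functional on the space of test functions, extended by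
  \<open>0\<close> to functions that are not test functions, so that equality of distributions is equality
  in HOL and pointwise subtraction is subtraction of distributions.
\<close>

definition distributions :: "functional set" where
  "distributions = {u.
     (\<forall>\<psi>. \<psi> \<notin> test_functions \<longrightarrow> u \<psi> = 0) \<and>
     (\<forall>\<psi>\<in>test_functions. \<forall>\<phi>\<in>test_functions. \<forall>a b.
        u (\<lambda>x. a * \<psi> x + b * \<phi> x) = a * u \<psi> + b * u \<phi>) \<and>
     (\<exists>C k. \<forall>\<psi>\<in>test_functions.
        cmod (u \<psi>) \<le> C * (\<Sum>j\<le>k. SUP x\<in>{0..2 * pi}. cmod (nth_deriv j \<psi> x)))}"

definition distr_of_fun :: "(real \<Rightarrow> complex) \<Rightarrow> functional" where
  "distr_of_fun f =
     (\<lambda>\<psi>. if \<psi> \<in> test_functions then of_real (1 / (2 * pi)) * (LBINT x:{0..2 * pi}. f x * \<psi> x) else 0)"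

definition expi :: "int \<Rightarrow> real \<Rightarrow> complex" where
  "expi n x = exp (\<i> * of_int n * of_real x)"

definition fourier_coeff :: "functional \<Rightarrow> int \<Rightarrow> complex" where
  "fourier_coeff u n = u (expi (- n))"

text \<open>
  The sum \<open>\<Sum>n. c n e\<^sup>i\<^sup>n\<^sup>x\<close> in the sense of distributions, i.e. tested against every test function.
\<close>

definition fourier_series :: "(int \<Rightarrow> complex) \<Rightarrow> functional" where
  "fourier_series c =
     (\<lambda>\<psi>. if \<psi> \<in> test_functions then \<Sum>\<^sub>\<infinity>n\<in>UNIV. c n * distr_of_fun (expi n) \<psi> else 0)"


section \<open>Sobolev spaces\<close>

definition sobolev :: "real \<Rightarrow> functional set" where
  "sobolev s = {u \<in> distributions.
     (\<lambda>n. (1 + (real_of_int n)\<^sup>2) powr s * (cmod (fourier_coeff u n))\<^sup>2) summable_on UNIV}"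

definition sobolev_norm :: "real \<Rightarrow> functional \<Rightarrow> real" where
  "sobolev_norm s u =
     sqrt (\<Sum>\<^sub>\<infinity>n\<in>UNIV. (1 + (real_of_int n)\<^sup>2) powr s * (cmod (fourier_coeff u n))\<^sup>2)"

definition sobolev_topology :: "real \<Rightarrow> functional topology" where
  "sobolev_topology s =
     topology_generated_by {{v \<in> sobolev s. sobolev_norm s (v - u) < r} |u r. u \<in> sobolev s \<and> 0 < r}"

definition X0 :: "functional set" where
  "X0 = (\<Inter>\<sigma>\<in>{0<..}. sobolev (- \<sigma>))"

text \<open>The coarsest topology for which all inclusions into the spaces \<open>H\<^sup>-\<^sup>\<sigma>\<close> are continuous.\<close>

definition X0_topology :: "functional topology" where
  "X0_topology =
     topology_generated_by {X0 \<inter> U |U \<sigma>. 0 < \<sigma> \<and> openin (sobolev_topology (- \<sigma>)) U}"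

definition borel_of_topology :: "'b topology \<Rightarrow> 'b measure" where
  "borel_of_topology T = sigma (topspace T) {U. openin T U}"


section \<open>The Gaussian measure\<close>

definition normalized_complex_gaussian :: "'a measure \<Rightarrow> ('a \<Rightarrow> complex) \<Rightarrow> bool" where
  "normalized_complex_gaussian P Z \<longleftrightarrow>
     (\<exists>h l :: 'a \<Rightarrow> real.
        prob_space.indep_var P borel h borel l \<and>
        distributed P lborel h (\<lambda>x. ennreal (std_normal_density x)) \<and>
        distributed P lborel l (\<lambda>x. ennreal (std_normal_density x)) \<and>
        (\<forall>\<omega>\<in>space P. Z \<omega> = of_real (1 / sqrt 2) * (of_real (h \<omega>) + \<i> * of_real (l \<omega>))))"

text \<open>
  The series belongs to \<open>X0\<close> almost surely; on the exceptional null set the value is set to the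
  zero distribution so that the random variable takes all its values in \<open>X0\<close>.
\<close>

definition random_series :: "(int \<Rightarrow> 'a \<Rightarrow> complex) \<Rightarrow> 'a \<Rightarrow> functional" where
  "random_series g \<omega> =
     (let u = fourier_series (\<lambda>n. g n \<omega> / of_real ((1 + \<bar>real_of_int n\<bar>) powr (1 / 2)))
      in if u \<in> X0 then u else (\<lambda>\<psi>. 0))"

definition gaussian_law :: "'a measure \<Rightarrow> (int \<Rightarrow> 'a \<Rightarrow> complex) \<Rightarrow> functional measure" where
  "gaussian_law P g = distr P (borel_of_topology X0_topology) (random_series g)"


section \<open>The truncated nonlinearity\<close>

definition fourier_proj :: "nat \<Rightarrow> functional \<Rightarrow> real \<Rightarrow> complex" where
  "fourier_proj N u = (\<lambda>x. \<Sum>n\<in>{- int N..int N}. fourier_coeff u n * expi n x)"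

definition L2_circle_norm :: "(real \<Rightarrow> complex) \<Rightarrow> real" where
  "L2_circle_norm f = sqrt (1 / (2 * pi) * (LBINT x:{0..2 * pi}. (cmod (f x))\<^sup>2))"

definition G :: "nat \<Rightarrow> functional \<Rightarrow> functional" where
  "G N u = (let v = fourier_proj N u in
     distr_of_fun (\<lambda>x.
       fourier_proj N (distr_of_fun (\<lambda>y. of_real ((cmod (v y))\<^sup>2) * v y)) x
       - 2 * of_real ((L2_circle_norm v)\<^sup>2) * v x))"


section \<open>Sobolev-valued Lebesgue spaces\<close>

definition Lp_norm :: "functional measure \<Rightarrow> real \<Rightarrow> real \<Rightarrow> (functional \<Rightarrow> functional) \<Rightarrow> ennreal" where
  "Lp_norm \<mu> p s F =
     (let I = \<integral>\<^sup>+u. ennreal (sobolev_norm s (F u) powr p) \<partial>\<mu>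
      in if I = \<top> then \<top> else ennreal (enn2real I powr (1 / p)))"

text \<open>
  Representatives of the elements of \<open>L\<^sup>p(\<mu>; H\<^sup>s)\<close>. As \<open>H\<^sup>s\<close> is separable, Borel measurability is
  the same as strong measurability.
\<close>

definition Lp_space :: "functional measure \<Rightarrow> real \<Rightarrow> real \<Rightarrow> (functional \<Rightarrow> functional) set" where
  "Lp_space \<mu> p s = {F \<in> \<mu> \<rightarrow>\<^sub>M borel_of_topology (sobolev_topology s). Lp_norm \<mu> p s F < \<top>}"

text \<open>Sequences are indexed from \<open>1\<close>.\<close>

definition Cauchy_in_Lp ::
  "functional measure \<Rightarrow> real \<Rightarrow> real \<Rightarrow> (nat \<Rightarrow> functional \<Rightarrow> functional) \<Rightarrow> bool" where
  "Cauchy_in_Lp \<mu> p s F \<longleftrightarrow>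
     (\<forall>N\<ge>1. F N \<in> Lp_space \<mu> p s) \<and>
     (\<forall>\<epsilon>>0. \<exists>K\<ge>1. \<forall>M\<ge>K. \<forall>N\<ge>K. Lp_norm \<mu> p s (\<lambda>u. F N u - F M u) < ennreal \<epsilon>)"

end

theory Submission
  imports Defs
begin

text \<open>
  Write \<open>c n\<close> for the Fourier coefficients of \<open>u\<close>. The coefficient of \<open>|u|\<^sup>2 u\<close> at \<open>n\<close> is the
  sum of \<open>c a * cnj (c b) * c d\<close> over \<open>a - b + d = n\<close>. Its divergent part comes from the pairings
  \<open>a = b\<close> and \<open>b = d\<close>, each of which contributes \<open>\<parallel>u\<parallel>\<^sup>2 c n\<close>. Subtracting \<open>2 \<parallel>u\<parallel>\<^sup>2 u\<close>
  removes both and leaves the triples in which \<open>b\<close> differs from \<open>a\<close> and \<open>d\<close>, and the diagonal ones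
  \<open>a = b = d\<close> with a minus sign (\<open>wick_ordering_identity\<close>). Hence \<open>G N u - G M u\<close> is a finite cubic form in
  the coefficients, over triples for which one of the frequencies \<open>n\<close>, \<open>a\<close>, \<open>b\<close>, \<open>d\<close> exceeds \<open>M\<close>.

  Under the Gaussian law every remaining monomial is a product, over the distinct frequencies, of one of the
  functions \<open>g\<close>, \<open>cnj g\<close>, \<open>g\<^sup>2\<close>, \<open>|g|\<^sup>2 g\<close> of independent Gaussians, all of which have mean zero.
  For such forms all moments are controlled by the sum of the squares of the coefficients
  (\<open>cubic_term_sum_moment\<close>). This instance of hypercontractivity is proved one variable at a time: perturbing a
  constant by a centred variable changes the square of an \<open>L\<^sup>p\<close> norm only to second order
  (\<open>centred_perturbation_moment\<close>), and Minkowski's inequality allows this to be iterated over the independent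
  variables (\<open>hypercontractive_tensorization\<close>).

  It remains to see that the sum of
  \<open>(1 + n\<^sup>2) powr (- \<sigma>) / ((1 + |a|) * (1 + |b|) * (1 + |d|))\<close> over triples with a frequency above
  \<open>M\<close> is at most a negative power of \<open>M\<close>. The weight of the largest frequency is distributed over the
  three smaller ones, which makes the sum over these converge absolutely, and a small power of it is kept
  as decay in \<open>M\<close> (\<open>triple_sum_decay\<close>). The Cauchy property then follows from the rate, because \<open>G N\<close> is a
  continuous function of finitely many Fourier coefficients (\<open>continuous_map_G\<close>) and has finite moments.
\<close>

section \<open>Moments of a centred perturbation\<close>

text \<open>
  With \<open>x = |z|\<^sup>2\<close>, \<open>t = 2 Re (\<bar>z W)\<close> and \<open>y = |W|\<^sup>2\<close> the left-hand side is \<open>|z + W|\<close>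
  raised to the power \<open>2 (k + 1)\<close>. The term of first order in \<open>W\<close> is kept exactly, because it is
  the one that disappears in the mean when \<open>W\<close> is centred; by \<open>t\<^sup>2 \<le> 4 x y\<close> everything else is of
  second order in \<open>W\<close>.
\<close>

lemma power_expansion_bound:
  "\<exists>K\<ge>0. \<forall>x y t::real. 0 \<le> x \<longrightarrow> 0 \<le> y \<longrightarrow> t\<^sup>2 \<le> 4 * x * y \<longrightarrow>
     (x + t + y) ^ Suc k \<le> x ^ Suc k + real (Suc k) * x ^ k * t + K * (x ^ k * y + y ^ Suc k)"
proof (induction k)
  case 0
  show ?case by (rule exI[of _ 1]) auto
next
  case (Suc k)
  then obtain K where K: "K \<ge> 0" and IH: "\<And>x y t::real. 0 \<le> x \<Longrightarrow> 0 \<le> y \<Longrightarrow> t\<^sup>2 \<le> 4 * x * y \<Longrightarrow>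
     (x + t + y) ^ Suc k \<le> x ^ Suc k + real (Suc k) * x ^ k * t + K * (x ^ k * y + y ^ Suc k)"
    by blast
  define L where "L = 1 + 6 * real (Suc k) + 6 * K"
  have "(x + t + y) ^ Suc (Suc k) \<le>
      x ^ Suc (Suc k) + real (Suc (Suc k)) * x ^ Suc k * t + L * (x ^ Suc k * y + y ^ Suc (Suc k))"
    if x: "0 \<le> x" and y: "0 \<le> y" and t: "t\<^sup>2 \<le> 4 * x * y" for x y t :: real
  proof -
    define A where "A = x ^ Suc k * y"
    define Y where "Y = y ^ Suc (Suc k)"
    have "t\<^sup>2 \<le> (x + y)\<^sup>2"
      using t sum_squares_bound[of x y] by (simp add: power2_sum)
    then have at: "\<bar>t\<bar> \<le> x + y"
      using x y abs_le_square_iff[of t "x + y"] by simp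
    then have s: "0 \<le> x + t + y" "x + t + y \<le> 2 * (x + y)" "t \<le> x + y" by (simp_all add: abs_le_iff)
    have AY: "0 \<le> A" "0 \<le> Y" using x y by (simp_all add: A_def Y_def)
    have m1: "x ^ k * y\<^sup>2 \<le> A + Y"
    proof (cases "x \<le> y")
      case True
      then have "x ^ k * y\<^sup>2 \<le> y ^ k * y\<^sup>2" using x y by (intro mult_right_mono power_mono) auto
      then show ?thesis using AY by (simp add: Y_def power2_eq_square mult_ac)
    next
      case False
      then have "x ^ k * (y * y) \<le> x ^ k * (x * y)" using x y by (intro mult_left_mono mult_right_mono) auto
      then show ?thesis using AY by (simp add: A_def power2_eq_square mult_ac)
    qed
    have m2: "x * y ^ Suc k \<le> A + Y"
    proof (cases "x \<le> y")
      case True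
      then have "x * y ^ Suc k \<le> y * y ^ Suc k" using x y by (intro mult_right_mono) auto
      then show ?thesis using AY by (simp add: Y_def)
    next
      case False
      then have "y ^ k * (x * y) \<le> x ^ k * (x * y)" using x y by (intro mult_right_mono power_mono) auto
      then show ?thesis using AY by (simp add: A_def mult_ac)
    qed
    have m3: "x ^ k * t\<^sup>2 \<le> 4 * A"
      using mult_left_mono[OF t, of "x ^ k"] x by (simp add: A_def mult_ac)
    have m4: "x ^ k * (t * y) \<le> 2 * A + Y"
    proof -
      have "x ^ k * (t * y) \<le> x ^ k * ((x + y) * y)"
        using x y s by (intro mult_left_mono mult_right_mono) auto
      also have "\<dots> = A + x ^ k * y\<^sup>2" by (simp add: A_def algebra_simps power2_eq_square)
      finally show ?thesis using m1 by simp
    qed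
    have m5: "(x + t + y) * (x ^ k * y + y ^ Suc k) \<le> 6 * (A + Y)"
    proof -
      have "(x + t + y) * (x ^ k * y + y ^ Suc k) \<le> (2 * (x + y)) * (x ^ k * y + y ^ Suc k)"
        using s x y by (intro mult_right_mono) auto
      also have "\<dots> = 2 * (A + x * y ^ Suc k + x ^ k * y\<^sup>2 + Y)"
        by (simp add: A_def Y_def algebra_simps power2_eq_square)
      also have "\<dots> \<le> 2 * (A + (A + Y) + (A + Y) + Y)"
        using m1 m2 by (intro mult_left_mono add_mono) auto
      finally show ?thesis by simp
    qed
    have "(x + t + y) ^ Suc (Suc k) = (x + t + y) * (x + t + y) ^ Suc k" by simp
    also have "\<dots> \<le> (x + t + y) * (x ^ Suc k + real (Suc k) * x ^ k * t + K * (x ^ k * y + y ^ Suc k))"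
      using s IH[OF x y t] by (intro mult_left_mono) auto
    also have "\<dots> = x ^ Suc (Suc k) + real (Suc (Suc k)) * x ^ Suc k * t + A
        + real (Suc k) * (x ^ k * t\<^sup>2 + x ^ k * (t * y))
        + K * ((x + t + y) * (x ^ k * y + y ^ Suc k))"
      by (simp add: A_def algebra_simps power2_eq_square)
    also have "\<dots> \<le> x ^ Suc (Suc k) + real (Suc (Suc k)) * x ^ Suc k * t + A
        + real (Suc k) * (4 * A + (2 * A + Y)) + K * (6 * (A + Y))"
      using K m3 m4 m5 by (intro add_mono mult_left_mono order_refl) auto
    also have "\<dots> \<le> x ^ Suc (Suc k) + real (Suc (Suc k)) * x ^ Suc k * t + L * (A + Y)"
    proof -
      have "0 \<le> real k * Y" using AY by simp
      then show ?thesis using AY by (simp add: L_def algebra_simps)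
    qed
    finally show ?thesis by (simp add: A_def Y_def)
  qed
  moreover have "L \<ge> 0" using K by (simp add: L_def)
  ultimately show ?case by blast
qed

text \<open>
  The second-order remainder left by the expansion fits into a single power if \<open>y\<close> gets a large
  enough coefficient; the coefficient of the leading term \<open>x\<close> stays equal to \<open>1\<close>, and this is what
  makes the estimate stable under iteration over many variables.
\<close>

lemma power_absorb:
  fixes x y K :: real
  assumes "0 \<le> x" "0 \<le> y" "0 \<le> K"
  shows "x ^ Suc k + K * (x ^ k * y + y ^ Suc k) \<le> (x + (2 * K + 1) * y) ^ Suc k"
proof -
  define s where "s = x + (2 * K + 1) * y"
  have xs: "x \<le> s" using assms by (simp add: s_def)
  have ys: "y \<le> s" using assms by (simp add: s_def algebra_simps)
  have 1: "x ^ k \<le> s ^ k" "y ^ k \<le> s ^ k" using xs ys assms by (auto intro: power_mono)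
  have "x ^ Suc k + K * (x ^ k * y + y ^ Suc k) = x * x ^ k + (K * y) * x ^ k + (K * y) * y ^ k"
    by (simp add: algebra_simps)
  also have "\<dots> \<le> x * s ^ k + (K * y) * s ^ k + (K * y) * s ^ k"
    using 1 assms by (intro add_mono mult_left_mono) auto
  also have "\<dots> \<le> s * s ^ k"
  proof -
    have "0 \<le> y * s ^ k" using xs assms by simp
    then show ?thesis by (simp add: s_def algebra_simps)
  qed
  finally show ?thesis by (simp add: s_def)
qed

text \<open>
  The one-variable form of hypercontractivity. A fixed number \<open>z\<close> is perturbed by a centred random
  variable \<open>W\<close> of size \<open>\<surd>B\<close>: in the norm of order \<open>2 (k + 1)\<close>, the square of the norm grows
  at most by \<open>C B\<close>, as it would in \<open>L\<^sup>2\<close> by orthogonality. The constant depends only on \<open>k\<close> and on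
  the bound \<open>m\<close> for the moments of the majorant \<open>Q\<close>, so that it can serve for all variables at once.
\<close>

lemma centred_perturbation_moment:
  obtains C :: real where "C \<ge> 1"
    "\<And>(M :: 'b measure) W Q B z. prob_space M \<Longrightarrow> integrable M W \<Longrightarrow> (\<integral>x. W x \<partial>M) = 0 \<Longrightarrow>
       integrable M Q \<Longrightarrow> integrable M (\<lambda>x. Q x ^ Suc k) \<Longrightarrow>
       (\<integral>x. Q x \<partial>M) \<le> m \<Longrightarrow> (\<integral>x. Q x ^ Suc k \<partial>M) \<le> m \<Longrightarrow>
       0 \<le> B \<Longrightarrow> (\<And>x. 0 \<le> Q x) \<Longrightarrow> (\<And>x. (cmod (W x))\<^sup>2 \<le> B * Q x) \<Longrightarrow>
       (\<integral>\<^sup>+x. ennreal (cmod (z + W x) ^ (2 * Suc k)) \<partial>M) \<le> ennreal (((cmod z)\<^sup>2 + C * B) ^ Suc k)"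
proof -
  obtain K :: real where K: "K \<ge> 0" and exp: "\<And>x y t::real. 0 \<le> x \<Longrightarrow> 0 \<le> y \<Longrightarrow> t\<^sup>2 \<le> 4 * x * y \<Longrightarrow>
     (x + t + y) ^ Suc k \<le> x ^ Suc k + real (Suc k) * x ^ k * t + K * (x ^ k * y + y ^ Suc k)"
    using power_expansion_bound[of k] by blast
  define L where "L = K * \<bar>m\<bar>"
  have L: "L \<ge> 0" using K by (simp add: L_def)
  show ?thesis
  proof (rule that[of "2 * L + 1"])
    show "2 * L + 1 \<ge> 1" using L by simp
    fix M :: "'b measure" and W Q B z
    assume M: "prob_space M" and iW: "integrable M W" and W0: "(\<integral>x. W x \<partial>M) = 0"
      and iQ: "integrable M Q" "integrable M (\<lambda>x. Q x ^ Suc k)"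
      and mQ: "(\<integral>x. Q x \<partial>M) \<le> m" "(\<integral>x. Q x ^ Suc k \<partial>M) \<le> m"
      and B: "0 \<le> B" and Q: "\<And>x. 0 \<le> Q x" and WQ: "\<And>x. (cmod (W x))\<^sup>2 \<le> B * Q x"
    interpret prob_space M by fact
    define a where "a = (cmod z)\<^sup>2"
    have a: "a \<ge> 0" by (simp add: a_def)
    \<comment> \<open>The pointwise majorant; its second summand is linear in \<open>W\<close> and has mean zero.\<close>
    define R where "R = (\<lambda>x. a ^ Suc k + (real (Suc k) * a ^ k * 2) * Re (cnj z * W x)
        + (K * a ^ k * B) * Q x + (K * B ^ Suc k) * Q x ^ Suc k)"
    have pt: "cmod (z + W x) ^ (2 * Suc k) \<le> R x" for x
    proof -
      define t where "t = 2 * Re (cnj z * W x)"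
      define y where "y = (cmod (W x))\<^sup>2"
      have "\<bar>t\<bar> \<le> 2 * (cmod z * cmod (W x))"
        using abs_Re_le_cmod[of "cnj z * W x"] by (simp add: t_def norm_mult)
      then have "t\<^sup>2 \<le> (2 * (cmod z * cmod (W x)))\<^sup>2"
        by (subst abs_le_square_iff[symmetric]) simp
      then have t2: "t\<^sup>2 \<le> 4 * a * y" by (simp add: a_def y_def power_mult_distrib)
      have "(cmod (z + W x))\<^sup>2 = a + t + y"
        unfolding a_def t_def y_def cmod_power2 by (simp add: power2_eq_square algebra_simps)
      then have "cmod (z + W x) ^ (2 * Suc k) = (a + t + y) ^ Suc k"
        by (simp only: power_mult)
      also have "\<dots> \<le> a ^ Suc k + real (Suc k) * a ^ k * t + K * (a ^ k * y + y ^ Suc k)"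
        using a t2 by (intro exp) (auto simp: y_def)
      also have "\<dots> \<le> a ^ Suc k + real (Suc k) * a ^ k * t + K * (a ^ k * (B * Q x) + (B * Q x) ^ Suc k)"
        using K a WQ[of x] by (intro add_mono mult_left_mono power_mono order_refl) (auto simp: y_def)
      also have "\<dots> = R x" by (simp add: R_def t_def algebra_simps power_mult_distrib)
      finally show ?thesis .
    qed
    have iR: "integrable M R" unfolding R_def
      using iW iQ by (intro Bochner_Integration.integrable_add integrable_mult_right integrable_Re integrable_const) auto
    have "(\<integral>x. R x \<partial>M) = a ^ Suc k + (K * a ^ k * B) * (\<integral>x. Q x \<partial>M) + (K * B ^ Suc k) * (\<integral>x. Q x ^ Suc k \<partial>M)"
    proof -
      have "(\<integral>x. Re (cnj z * W x) \<partial>M) = Re (\<integral>x. cnj z * W x \<partial>M)"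
        using iW by (intro integral_Re) auto
      also have "\<dots> = 0" using W0 by simp
      finally have 0: "(\<integral>x. Re (cnj z * W x) \<partial>M) = 0" .
      show ?thesis unfolding R_def
        using iW iQ 0 by (subst Bochner_Integration.integral_add Bochner_Integration.integrable_add
            | (intro Bochner_Integration.integrable_add integrable_mult_right integrable_Re integrable_const; simp)
            | simp add: prob_space)+
    qed
    also have "\<dots> \<le> a ^ Suc k + (K * a ^ k * B) * \<bar>m\<bar> + (K * B ^ Suc k) * \<bar>m\<bar>"
      using mQ K a B by (intro add_mono mult_left_mono order_refl) auto
    also have "\<dots> = a ^ Suc k + L * (a ^ k * B + B ^ Suc k)" by (simp add: L_def algebra_simps)
    also have "\<dots> \<le> (a + (2 * L + 1) * B) ^ Suc k" by (rule power_absorb) (use a B L in auto)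
    finally have fin: "(\<integral>x. R x \<partial>M) \<le> (a + (2 * L + 1) * B) ^ Suc k" .
    have R0: "0 \<le> R x" for x by (rule order_trans[OF _ pt]) simp
    have "(\<integral>\<^sup>+x. ennreal (cmod (z + W x) ^ (2 * Suc k)) \<partial>M) \<le> (\<integral>\<^sup>+x. ennreal (R x) \<partial>M)"
      by (intro nn_integral_mono ennreal_leI pt)
    also have "\<dots> = ennreal (\<integral>x. R x \<partial>M)" using iR R0 by (intro nn_integral_eq_integral) auto
    also have "\<dots> \<le> ennreal ((a + (2 * L + 1) * B) ^ Suc k)" using fin by (rule ennreal_leI)
    finally show "(\<integral>\<^sup>+x. ennreal (cmod (z + W x) ^ (2 * Suc k)) \<partial>M) \<le> ennreal (((cmod z)\<^sup>2 + (2 * L + 1) * B) ^ Suc k)"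
      by (simp add: a_def)
  qed
qed

section \<open>Hypercontractivity by tensorization\<close>

lemma convex_on_power_nonneg: "convex_on {0::real..} (\<lambda>x. x ^ n)"
proof (cases "even n")
  case True
  then show ?thesis by (intro convex_on_subset[OF convex_power_even]) auto
qed (simp add: convex_power_odd)

text \<open>
  Minkowski's inequality in \<open>L\<^sup>k\<close> for nonnegative functions, stated without norms. If
  \<open>s = \<Sum> c\<^sub>j m\<^sub>j\<close>, then \<open>\<Sum> c\<^sub>j X\<^sub>j / s\<close> is a convex combination of the functions \<open>X\<^sub>j / m\<^sub>j\<close>, so
  convexity of the \<open>k\<close>-th power gives the bound; adding \<open>\<epsilon>\<close> to each \<open>m\<^sub>j\<close> avoids division
  by zero.
\<close>

lemma nn_integral_power_sum_le:
  fixes X :: "'j \<Rightarrow> 'b \<Rightarrow> real"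
  assumes J: "finite J" and k: "0 < k"
    and meas: "\<And>j. j \<in> J \<Longrightarrow> X j \<in> borel_measurable M"
    and X: "\<And>j x. j \<in> J \<Longrightarrow> 0 \<le> X j x" and c: "\<And>j. j \<in> J \<Longrightarrow> 0 \<le> c j" and m: "\<And>j. j \<in> J \<Longrightarrow> 0 \<le> m j"
    and bd: "\<And>j. j \<in> J \<Longrightarrow> (\<integral>\<^sup>+x. ennreal (X j x ^ k) \<partial>M) \<le> ennreal (m j ^ k)"
  shows "(\<integral>\<^sup>+x. ennreal ((\<Sum>j\<in>J. c j * X j x) ^ k) \<partial>M) \<le> ennreal ((\<Sum>j\<in>J. c j * m j) ^ k)"
proof -
  have eps: "(\<integral>\<^sup>+x. ennreal ((\<Sum>j\<in>J. c j * X j x) ^ k) \<partial>M) \<le> ennreal ((\<Sum>j\<in>J. c j * (m j + e)) ^ k)"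
    if e: "e > 0" for e :: real
  proof -
    define s where "s = (\<Sum>j\<in>J. c j * (m j + e))"
    have s0: "0 \<le> s" unfolding s_def using c m e by (intro sum_nonneg mult_nonneg_nonneg add_nonneg_nonneg) auto
    show ?thesis
    proof (cases "s = 0")
      case True
      have "\<forall>j\<in>J. c j * (m j + e) = 0"
        using True J c m e unfolding s_def by (subst (asm) sum_nonneg_eq_0_iff) (auto intro!: mult_nonneg_nonneg add_nonneg_nonneg)
      then have "\<forall>j\<in>J. c j = 0" using m e by (metis add_nonneg_pos mult_eq_0_iff order_less_irrefl)
      then show ?thesis using k by (simp add: zero_power)
    next
      case False
      then have s: "s > 0" using s0 by simp
      define w where "w = (\<lambda>j. c j * (m j + e) / s)"
      have me: "m j + e > 0" if "j \<in> J" for j using m[OF that] e by simp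
      have w0: "0 \<le> w j" if "j \<in> J" for j using c[OF that] me[OF that] s by (simp add: w_def)
      have w1: "(\<Sum>j\<in>J. w j) = 1" using s by (simp add: w_def s_def sum_divide_distrib[symmetric])
      have pt: "(\<Sum>j\<in>J. c j * X j x) ^ k \<le> s ^ k * (\<Sum>j\<in>J. w j / (m j + e) ^ k * X j x ^ k)" for x
      proof -
        have Jn: "J \<noteq> {}" using w1 by auto
        have "(\<Sum>j\<in>J. c j * X j x) = s * (\<Sum>j\<in>J. w j *\<^sub>R (X j x / (m j + e)))"
          unfolding sum_distrib_left using s me by (intro sum.cong refl) (force simp: w_def)
        then have "(\<Sum>j\<in>J. c j * X j x) ^ k = s ^ k * (\<Sum>j\<in>J. w j *\<^sub>R (X j x / (m j + e))) ^ k"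
          by (simp add: power_mult_distrib)
        also have "\<dots> \<le> s ^ k * (\<Sum>j\<in>J. w j * (X j x / (m j + e)) ^ k)"
          using w0 w1 X me s0 J Jn
          by (intro mult_left_mono convex_on_sum[OF J Jn convex_on_power_nonneg]) (auto intro!: divide_nonneg_pos)
        finally show ?thesis by (simp add: power_divide)
      qed
      have "(\<integral>\<^sup>+x. ennreal ((\<Sum>j\<in>J. c j * X j x) ^ k) \<partial>M)
          \<le> (\<integral>\<^sup>+x. ennreal (s ^ k * (\<Sum>j\<in>J. w j / (m j + e) ^ k * X j x ^ k)) \<partial>M)"
        by (intro nn_integral_mono ennreal_leI pt)
      also have "\<dots> = (\<integral>\<^sup>+x. (\<Sum>j\<in>J. ennreal (s ^ k * (w j / (m j + e) ^ k)) * ennreal (X j x ^ k)) \<partial>M)"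
      proof (intro nn_integral_cong)
        fix x
        have nn: "0 \<le> s ^ k * (w j / (m j + e) ^ k)" if "j \<in> J" for j
          using w0[OF that] me[OF that] s by (auto intro!: mult_nonneg_nonneg divide_nonneg_nonneg)
        have "(\<Sum>j\<in>J. ennreal (s ^ k * (w j / (m j + e) ^ k)) * ennreal (X j x ^ k))
            = (\<Sum>j\<in>J. ennreal (s ^ k * (w j / (m j + e) ^ k) * X j x ^ k))"
          by (intro sum.cong refl ennreal_mult[symmetric] nn zero_le_power X)
        also have "\<dots> = ennreal (\<Sum>j\<in>J. s ^ k * (w j / (m j + e) ^ k) * X j x ^ k)"
          by (intro sum_ennreal mult_nonneg_nonneg[OF nn] zero_le_power X)
        finally show "ennreal (s ^ k * (\<Sum>j\<in>J. w j / (m j + e) ^ k * X j x ^ k)) =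
          (\<Sum>j\<in>J. ennreal (s ^ k * (w j / (m j + e) ^ k)) * ennreal (X j x ^ k))"
          by (simp add: sum_distrib_left mult.assoc)
      qed
      also have "\<dots> = (\<Sum>j\<in>J. ennreal (s ^ k * (w j / (m j + e) ^ k)) * (\<integral>\<^sup>+x. ennreal (X j x ^ k) \<partial>M))"
        using meas by (subst nn_integral_sum) (auto intro!: sum.cong nn_integral_cmult)
      also have "\<dots> \<le> (\<Sum>j\<in>J. ennreal (s ^ k * w j))"
      proof (intro sum_mono)
        fix j assume j: "j \<in> J"
        have "ennreal (s ^ k * (w j / (m j + e) ^ k)) * (\<integral>\<^sup>+x. ennreal (X j x ^ k) \<partial>M)
          \<le> ennreal (s ^ k * (w j / (m j + e) ^ k)) * ennreal ((m j + e) ^ k)"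
          using bd[OF j] m[OF j] e
          by (intro mult_left_mono order_trans[OF bd[OF j]] ennreal_leI power_mono) auto
        also have "\<dots> = ennreal (s ^ k * w j)"
          using me[OF j] w0[OF j] s by (subst ennreal_mult'[symmetric]) auto
        finally show "ennreal (s ^ k * (w j / (m j + e) ^ k)) * (\<integral>\<^sup>+x. ennreal (X j x ^ k) \<partial>M) \<le> ennreal (s ^ k * w j)" .
      qed
      also have "\<dots> = ennreal (s ^ k)"
        using w0 s0 w1 by (subst sum_ennreal) (auto simp: sum_distrib_left[symmetric])
      finally show ?thesis by (simp add: s_def)
    qed
  qed
  have "((\<lambda>e. ennreal ((\<Sum>j\<in>J. c j * (m j + e)) ^ k)) \<longlongrightarrow> ennreal ((\<Sum>j\<in>J. c j * (m j + 0)) ^ k)) (at_right 0)"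
    by (intro tendsto_ennrealI tendsto_intros)
  then have "(\<integral>\<^sup>+x. ennreal ((\<Sum>j\<in>J. c j * X j x) ^ k) \<partial>M) \<le> ennreal ((\<Sum>j\<in>J. c j * (m j + 0)) ^ k)"
    by (rule tendsto_lowerbound) (auto simp: eventually_at_right_less intro!: eventually_at_rightI[of 0 1] eps)
  then show ?thesis by simp
qed

text \<open>
  If linear combinations of the letters \<open>\<phi> j\<close> in a single variable obey an \<open>L\<^sup>2\<close>-type bound with
  weights \<open>c j\<close>, then so do linear combinations of words, that is, of products with one letter for each
  of finitely many independent variables, the weight of a word being the product of the weights of its
  letters. In the induction step the one-variable bound is applied to the new variable with the others
  frozen, and Minkowski's inequality then lets the induction hypothesis be used for the part of the
  sum belonging to each letter. Words are indexed by a set \<open>B\<close> through an injective map \<open>T\<close>.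
\<close>

lemma hypercontractive_tensorization:
  fixes \<gamma> :: "'i \<Rightarrow> 'b measure" and \<phi> :: "'j \<Rightarrow> 'b \<Rightarrow> complex" and T :: "'t \<Rightarrow> 'i \<Rightarrow> 'j"
  assumes prob: "\<And>i. prob_space (\<gamma> i)" and J: "finite J"
    and meas: "\<And>i j. j \<in> J \<Longrightarrow> \<phi> j \<in> borel_measurable (\<gamma> i)" and c: "\<And>j. j \<in> J \<Longrightarrow> 0 \<le> c j"
    and one: "\<And>i f. (\<integral>\<^sup>+x. ennreal (cmod (\<Sum>j\<in>J. f j * \<phi> j x) ^ (2 * Suc k)) \<partial>\<gamma> i)
                \<le> ennreal ((\<Sum>j\<in>J. c j * (cmod (f j))\<^sup>2) ^ Suc k)"
    and I: "finite I" and B: "finite B" and T: "\<And>t i. t \<in> B \<Longrightarrow> i \<in> I \<Longrightarrow> T t i \<in> J"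
    and inj: "inj_on (\<lambda>t. restrict (T t) I) B"
  shows "(\<integral>\<^sup>+x. ennreal (cmod (\<Sum>t\<in>B. a t * (\<Prod>i\<in>I. \<phi> (T t i) (x i))) ^ (2 * Suc k)) \<partial>Pi\<^sub>M I \<gamma>)
     \<le> ennreal ((\<Sum>t\<in>B. (cmod (a t))\<^sup>2 * (\<Prod>i\<in>I. c (T t i))) ^ Suc k)"
  using I B T inj
proof (induction I arbitrary: B rule: finite_induct)
  case empty
  interpret prob_space "Pi\<^sub>M {} \<gamma>" by (intro prob_space_PiM prob)
  have "B = {} \<or> (\<exists>t. B = {t})"
  proof (cases "B = {}")
    case False
    then obtain t where "t \<in> B" by blast
    then have "u = t" if "u \<in> B" for u by (intro inj_onD[OF empty.prems(3) _ that]) auto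
    with \<open>t \<in> B\<close> have "B = {t}" by blast
    then show ?thesis by blast
  qed simp
  then show ?case
    by (auto simp: emeasure_space_1 power_mult simp del: power_Suc mult_Suc_right)
next
  case (insert m I)
  interpret product_prob_space \<gamma>
    using prob by (simp add: product_prob_space_def product_sigma_finite_def
        product_prob_space_axioms_def prob_space_imp_sigma_finite)
  define Bj where "Bj = (\<lambda>j. {t \<in> B. T t m = j})"
  define F where "F = (\<lambda>j x. \<Sum>t\<in>Bj j. a t * (\<Prod>i\<in>I. \<phi> (T t i) (x i)))"
  have Bj: "finite (Bj j)" "Bj j \<subseteq> B" for j using insert.prems(1) by (auto simp: Bj_def)
  have split: "(\<Sum>t\<in>B. h t) = (\<Sum>j\<in>J. \<Sum>t\<in>Bj j. h t)" for h :: "'t \<Rightarrow> 'd::comm_monoid_add"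
    unfolding Bj_def using insert.prems(1,2) J by (intro sum.group[symmetric]) auto
  have comp: "(\<lambda>x. \<phi> (T t i) (x i)) \<in> borel_measurable (Pi\<^sub>M S \<gamma>)" if "t \<in> B" "i \<in> insert m I" "i \<in> S" for t i S
    using that insert.prems(2) by (intro measurable_compose[OF measurable_component_singleton[OF that(3)] meas]) auto
  have measF: "F j \<in> borel_measurable (Pi\<^sub>M I \<gamma>)" for j
    unfolding F_def by (intro borel_measurable_sum borel_measurable_times borel_measurable_const
        borel_measurable_prod comp) (auto simp: Bj_def)
  have meas_all: "(\<lambda>x. ennreal (cmod (\<Sum>t\<in>B. a t * (\<Prod>i\<in>insert m I. \<phi> (T t i) (x i))) ^ (2 * Suc k)))
      \<in> borel_measurable (Pi\<^sub>M (insert m I) \<gamma>)"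
  proof -
    have [measurable]: "(\<lambda>x. \<Sum>t\<in>B. a t * (\<Prod>i\<in>insert m I. \<phi> (T t i) (x i)))
        \<in> borel_measurable (Pi\<^sub>M (insert m I) \<gamma>)"
      by (intro borel_measurable_sum borel_measurable_times borel_measurable_const
          borel_measurable_prod comp) auto
    show ?thesis by measurable
  qed
  have upd: "(\<Sum>t\<in>B. a t * (\<Prod>i\<in>insert m I. \<phi> (T t i) ((x(m := y)) i))) = (\<Sum>j\<in>J. F j x * \<phi> j y)" for x y
  proof -
    have "(\<Prod>i\<in>insert m I. \<phi> (T t i) ((x(m := y)) i)) = \<phi> (T t m) y * (\<Prod>i\<in>I. \<phi> (T t i) (x i))" for t
      using insert.hyps by (auto intro!: prod.cong)
    then show ?thesis
      unfolding split F_def sum_distrib_right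
      by (intro sum.cong refl) (auto simp: Bj_def mult_ac)
  qed
  have measF2: "(\<lambda>x. (cmod (F j x))\<^sup>2) \<in> borel_measurable (Pi\<^sub>M I \<gamma>)" for j
    using measF[of j] by measurable
  have IH: "(\<integral>\<^sup>+x. ennreal (((cmod (F j x))\<^sup>2) ^ Suc k) \<partial>Pi\<^sub>M I \<gamma>)
      \<le> ennreal ((\<Sum>t\<in>Bj j. (cmod (a t))\<^sup>2 * (\<Prod>i\<in>I. c (T t i))) ^ Suc k)" for j
  proof -
    have "inj_on (\<lambda>t. restrict (T t) I) (Bj j)"
    proof (rule inj_onI)
      fix t t' assume tt: "t \<in> Bj j" "t' \<in> Bj j" "restrict (T t) I = restrict (T t') I"
      have "restrict (T t) (insert m I) = restrict (T t') (insert m I)"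
        using tt by (auto simp: restrict_def fun_eq_iff Bj_def split: if_splits)
      then show "t = t'" by (rule inj_onD[OF insert.prems(3)]) (use tt in \<open>auto simp: Bj_def\<close>)
    qed
    moreover have "T t i \<in> J" if "t \<in> Bj j" "i \<in> I" for t i
      using that insert.prems(2) Bj(2)[of j] by auto
    ultimately show ?thesis
      using insert.IH[of "Bj j"] Bj(1)[of j]
      unfolding F_def power_mult by blast
  qed
  have "(\<integral>\<^sup>+x. ennreal (cmod (\<Sum>t\<in>B. a t * (\<Prod>i\<in>insert m I. \<phi> (T t i) (x i))) ^ (2 * Suc k)) \<partial>Pi\<^sub>M (insert m I) \<gamma>)
     = (\<integral>\<^sup>+x. \<integral>\<^sup>+y. ennreal (cmod (\<Sum>j\<in>J. F j x * \<phi> j y) ^ (2 * Suc k)) \<partial>\<gamma> m \<partial>Pi\<^sub>M I \<gamma>)"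
    by (subst product_nn_integral_insert[OF insert.hyps meas_all]) (simp only: upd)
  also have "\<dots> \<le> (\<integral>\<^sup>+x. ennreal ((\<Sum>j\<in>J. c j * (cmod (F j x))\<^sup>2) ^ Suc k) \<partial>Pi\<^sub>M I \<gamma>)"
    by (intro nn_integral_mono one)
  also have "\<dots> \<le> ennreal ((\<Sum>j\<in>J. c j * (\<Sum>t\<in>Bj j. (cmod (a t))\<^sup>2 * (\<Prod>i\<in>I. c (T t i)))) ^ Suc k)"
  proof (rule nn_integral_power_sum_le[OF J _ _ _ c])
    show "0 \<le> (\<Sum>t\<in>Bj j. (cmod (a t))\<^sup>2 * (\<Prod>i\<in>I. c (T t i)))" for j
      using c insert.prems(2) Bj by (intro sum_nonneg mult_nonneg_nonneg prod_nonneg) (auto simp: Bj_def)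
  qed (use IH measF2 in auto)
  also have "(\<Sum>j\<in>J. c j * (\<Sum>t\<in>Bj j. (cmod (a t))\<^sup>2 * (\<Prod>i\<in>I. c (T t i))))
     = (\<Sum>t\<in>B. (cmod (a t))\<^sup>2 * (\<Prod>i\<in>insert m I. c (T t i)))"
    unfolding split sum_distrib_left using insert.hyps
    by (intro sum.cong refl) (auto simp: Bj_def mult_ac)
  finally show ?case .
qed

section \<open>Gaussian letters\<close>

lemma integral_Complex_zero:
  fixes p q :: "'a \<Rightarrow> real"
  assumes "integrable M p" "integrable M q" "(\<integral>x. p x \<partial>M) = 0" "(\<integral>x. q x \<partial>M) = 0"
    and "\<And>x. x \<in> space M \<Longrightarrow> f x = of_real (p x) + \<i> * of_real (q x)"
  shows "integrable M f \<and> (\<integral>x. f x \<partial>M) = 0"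
proof -
  have eq: "integrable M f \<longleftrightarrow> integrable M (\<lambda>x. complex_of_real (p x) + \<i> * of_real (q x))"
    "(\<integral>x. f x \<partial>M) = (\<integral>x. complex_of_real (p x) + \<i> * of_real (q x) \<partial>M)"
    using assms(5) by (auto intro!: Bochner_Integration.integrable_cong Bochner_Integration.integral_cong)
  show ?thesis unfolding eq using assms(1-4)
    by (subst Bochner_Integration.integral_add) (auto)
qed

text \<open>
  The letter selected by three flags is the contribution of one Gaussian variable \<open>z\<close> to a monomial
  \<open>z\<^sub>a cnj z\<^sub>b z\<^sub>d\<close>: the flags tell which of the three positions the variable occupies.
\<close>

definition letter :: "bool \<times> bool \<times> bool \<Rightarrow> complex \<Rightarrow> complex" where
  "letter = (\<lambda>(x, y, w) z. (if x then z else 1) * (if y then cnj z else 1) * (if w then z else 1))"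

definition no_letter :: "bool \<times> bool \<times> bool" where "no_letter = (False, False, False)"

text \<open>
  The letters \<open>z\<close>, \<open>cnj z\<close>, \<open>z\<close>, \<open>z\<^sup>2\<close> and \<open>|z|\<^sup>2 z\<close>. The two remaining nontrivial choices of flags
  give \<open>|z|\<^sup>2\<close>, whose mean is not zero; these are the pairings removed by the renormalization.
\<close>

definition centred_letters :: "(bool \<times> bool \<times> bool) set" where
  "centred_letters = {(True, False, False), (False, True, False), (False, False, True),
     (True, False, True), (True, True, True)}"

lemma letter_no_letter [simp]: "letter no_letter z = 1"
  by (simp add: letter_def no_letter_def)

lemma finite_centred_letters [simp]: "finite centred_letters"
  by (simp add: centred_letters_def)

lemma no_letter_not_centred [simp]: "no_letter \<notin> centred_letters"
  by (simp add: centred_letters_def no_letter_def)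

lemma borel_measurable_letter [measurable]: "letter j \<in> borel_measurable borel"
  proof -
  obtain a b c where j: "j = (a, b, c)" by (cases j)
  have "continuous_on UNIV (letter j)"
    unfolding letter_def j by (cases a; cases b; cases c) (auto intro!: continuous_intros)
  then show ?thesis by (rule borel_measurable_continuous_onI)
qed

context prob_space
begin

lemma normalized_complex_gaussian_measurable:
  assumes "normalized_complex_gaussian M Z"
  shows "Z \<in> borel_measurable M"
proof -
  from assms obtain h l where
    hl: "distributed M lborel h (\<lambda>x. ennreal (std_normal_density x))"
        "distributed M lborel l (\<lambda>x. ennreal (std_normal_density x))"
    and Z: "\<And>\<omega>. \<omega> \<in> space M \<Longrightarrow> Z \<omega> = of_real (1 / sqrt 2) * (of_real (h \<omega>) + \<i> * of_real (l \<omega>))"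
    unfolding normalized_complex_gaussian_def by blast
  have [measurable]: "h \<in> borel_measurable M" "l \<in> borel_measurable M"
    using hl[THEN distributed_measurable] by simp_all
  have "(\<lambda>\<omega>. complex_of_real (1 / sqrt 2) * (of_real (h \<omega>) + \<i> * of_real (l \<omega>))) \<in> borel_measurable M"
    by measurable
  then show ?thesis using measurable_cong[of M Z, OF Z] by simp
qed

lemma std_normal_power_moments:
  assumes "distributed M lborel X (\<lambda>x. ennreal (std_normal_density x))"
  shows "integrable M (\<lambda>\<omega>. X \<omega> ^ n)" "integrable M (\<lambda>\<omega>. \<bar>X \<omega>\<bar> ^ n)"
    and "(\<integral>\<omega>. X \<omega> ^ n \<partial>M) = (\<integral>x. std_normal_density x * x ^ n \<partial>lborel)"
    and "(\<integral>\<omega>. \<bar>X \<omega>\<bar> ^ n \<partial>M) = (\<integral>x. std_normal_density x * \<bar>x\<bar> ^ n \<partial>lborel)"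
  using distributed_integrable[OF assms, of "\<lambda>x. x ^ n"] distributed_integrable[OF assms, of "\<lambda>x. \<bar>x\<bar> ^ n"]
    distributed_integral[OF assms, of "\<lambda>x. x ^ n"] distributed_integral[OF assms, of "\<lambda>x. \<bar>x\<bar> ^ n"]
    integrable_std_normal_moment[of n] integrable_std_normal_moment_abs[of n]
  by simp_all

lemma normalized_complex_gaussian_abs_moment:
  assumes "normalized_complex_gaussian M Z"
  shows "integrable M (\<lambda>\<omega>. cmod (Z \<omega>) ^ n)"
    and "(\<integral>\<omega>. cmod (Z \<omega>) ^ n \<partial>M) \<le> 2 ^ n * (2 * (\<integral>x. std_normal_density x * \<bar>x\<bar> ^ n \<partial>lborel))"
proof -
  from assms obtain h l where
    hl: "distributed M lborel h (\<lambda>x. ennreal (std_normal_density x))"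
        "distributed M lborel l (\<lambda>x. ennreal (std_normal_density x))"
    and Z: "\<And>\<omega>. \<omega> \<in> space M \<Longrightarrow> Z \<omega> = of_real (1 / sqrt 2) * (of_real (h \<omega>) + \<i> * of_real (l \<omega>))"
    unfolding normalized_complex_gaussian_def by blast
  note [measurable] = normalized_complex_gaussian_measurable[OF assms]
  have bd: "cmod (Z \<omega>) ^ n \<le> 2 ^ n * (\<bar>h \<omega>\<bar> ^ n + \<bar>l \<omega>\<bar> ^ n)" if "\<omega> \<in> space M" for \<omega>
  proof -
    have "cmod (Z \<omega>) \<le> 1 * (\<bar>h \<omega>\<bar> + \<bar>l \<omega>\<bar>)"
      unfolding Z[OF that] norm_mult
      by (intro mult_mono order_trans[OF norm_triangle_ineq]) (auto simp: norm_mult norm_divide real_le_rsqrt)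
    also have "\<dots> \<le> 2 * max \<bar>h \<omega>\<bar> \<bar>l \<omega>\<bar>" by simp
    finally have "cmod (Z \<omega>) ^ n \<le> (2 * max \<bar>h \<omega>\<bar> \<bar>l \<omega>\<bar>) ^ n" by (intro power_mono) auto
    also have "\<dots> = 2 ^ n * (max \<bar>h \<omega>\<bar> \<bar>l \<omega>\<bar>) ^ n" by (simp add: power_mult_distrib)
    also have "\<dots> \<le> 2 ^ n * (\<bar>h \<omega>\<bar> ^ n + \<bar>l \<omega>\<bar> ^ n)" by (intro mult_left_mono) (auto simp: max_def)
    finally show ?thesis .
  qed
  have i: "integrable M (\<lambda>\<omega>. 2 ^ n * (\<bar>h \<omega>\<bar> ^ n + \<bar>l \<omega>\<bar> ^ n))"
    using std_normal_power_moments[OF hl(1)] std_normal_power_moments[OF hl(2)] by auto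
  show int: "integrable M (\<lambda>\<omega>. cmod (Z \<omega>) ^ n)"
    by (rule Bochner_Integration.integrable_bound[OF i]) (use bd in \<open>auto intro!: AE_I2\<close>)
  have "(\<integral>\<omega>. cmod (Z \<omega>) ^ n \<partial>M) \<le> (\<integral>\<omega>. 2 ^ n * (\<bar>h \<omega>\<bar> ^ n + \<bar>l \<omega>\<bar> ^ n) \<partial>M)"
    by (intro integral_mono int i bd)
  also have "\<dots> = 2 ^ n * (2 * (\<integral>x. std_normal_density x * \<bar>x\<bar> ^ n \<partial>lborel))"
    using std_normal_power_moments[OF hl(1), of n] std_normal_power_moments[OF hl(2), of n] by simp
  finally show "(\<integral>\<omega>. cmod (Z \<omega>) ^ n \<partial>M) \<le> 2 ^ n * (2 * (\<integral>x. std_normal_density x * \<bar>x\<bar> ^ n \<partial>lborel))" .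
qed

lemma centred_letter_mean:
  assumes "normalized_complex_gaussian M Z" and "j \<in> centred_letters"
  shows "integrable M (\<lambda>\<omega>. letter j (Z \<omega>)) \<and> (\<integral>\<omega>. letter j (Z \<omega>) \<partial>M) = 0"
proof -
  from assms obtain h l where indep: "indep_var borel h borel l" and
    hl: "distributed M lborel h (\<lambda>x. ennreal (std_normal_density x))"
        "distributed M lborel l (\<lambda>x. ennreal (std_normal_density x))"
    and Z: "\<And>\<omega>. \<omega> \<in> space M \<Longrightarrow> Z \<omega> = of_real (1 / sqrt 2) * (of_real (h \<omega>) + \<i> * of_real (l \<omega>))"
    unfolding normalized_complex_gaussian_def by blast
  define \<mu> where "\<mu> = (\<lambda>n. \<integral>x. std_normal_density x * x ^ n \<partial>lborel)"
  have \<mu>: "\<mu> (Suc 0) = 0" "\<mu> 3 = 0"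
    using integral_std_normal_moment_odd[of 0] integral_std_normal_moment_odd[of 1] by (simp_all add: \<mu>_def)
  have \<mu>': "(\<integral>x. std_normal_density x * x ^ n \<partial>lborel) = \<mu> n" for n
    by (simp only: \<mu>_def)
  note mom = std_normal_power_moments(1,3)[OF hl(1), unfolded \<mu>'] std_normal_power_moments(1,3)[OF hl(2), unfolded \<mu>']
  have ip: "indep_var borel (\<lambda>\<omega>. h \<omega> ^ a) borel (\<lambda>\<omega>. l \<omega> ^ b)" for a b
    using indep_var_compose[OF indep, of "\<lambda>x. x ^ a" borel "\<lambda>x. x ^ b" borel] by (simp add: comp_def)
  have prod: "integrable M (\<lambda>\<omega>. h \<omega> ^ a * l \<omega> ^ b)" "(\<integral>\<omega>. h \<omega> ^ a * l \<omega> ^ b \<partial>M) = \<mu> a * \<mu> b" for a b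
    using indep_var_integrable[OF ip[of a b] mom(1) mom(3)] indep_var_lebesgue_integral[OF ip[of a b] mom(1) mom(3)]
    by (simp_all only: mom)
  define r :: real where "r = 1 / sqrt 2"
  have r2: "complex_of_real r * (complex_of_real r * x) = x / 2" for x
    by (simp add: r_def mult.assoc[symmetric] of_real_mult[symmetric] del: of_real_mult)
  have Z': "Z \<omega> = of_real r * (of_real (h \<omega>) + \<i> * of_real (l \<omega>))" if "\<omega> \<in> space M" for \<omega>
    using Z[OF that] by (simp add: r_def)
  note pr = prod[of 1 0] prod[of 0 1] prod[of 2 0] prod[of 0 2] prod[of 1 1] prod[of 3 0] prod[of 1 2] prod[of 2 1] prod[of 0 3]
  have \<mu>0: "\<mu> 0 = 1" using mom(2)[of 0] by (simp add: prob_space)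
  have 1: "integrable M (\<lambda>\<omega>. letter j (Z \<omega>)) \<and> (\<integral>\<omega>. letter j (Z \<omega>) \<partial>M) = 0"
    if "j = (True, False, False) \<or> j = (False, False, True)"
    by (rule integral_Complex_zero[of _ "\<lambda>\<omega>. r * h \<omega>" "\<lambda>\<omega>. r * l \<omega>"])
      (use that pr in \<open>auto simp: \<mu> \<mu>0 letter_def Z' algebra_simps\<close>)
  have 2: "integrable M (\<lambda>\<omega>. letter j (Z \<omega>)) \<and> (\<integral>\<omega>. letter j (Z \<omega>) \<partial>M) = 0"
    if "j = (False, True, False)"
    by (rule integral_Complex_zero[of _ "\<lambda>\<omega>. r * h \<omega>" "\<lambda>\<omega>. - r * l \<omega>"])
      (use that pr in \<open>auto simp: \<mu> \<mu>0 letter_def Z' algebra_simps\<close>)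
  have 3: "integrable M (\<lambda>\<omega>. letter j (Z \<omega>)) \<and> (\<integral>\<omega>. letter j (Z \<omega>) \<partial>M) = 0"
    if "j = (True, False, True)"
  proof (rule integral_Complex_zero[of _ "\<lambda>\<omega>. r * r * (h \<omega> ^ 2 - l \<omega> ^ 2)" "\<lambda>\<omega>. 2 * r * r * (h \<omega> * l \<omega>)"])
    show "letter j (Z \<omega>) = of_real (r * r * (h \<omega> ^ 2 - l \<omega> ^ 2)) + \<i> * of_real (2 * r * r * (h \<omega> * l \<omega>))"
      if "\<omega> \<in> space M" for \<omega>
      using that \<open>j = _\<close> by (simp add: letter_def Z' algebra_simps power2_eq_square)
  qed (use pr in \<open>simp_all add: \<mu> \<mu>0\<close>)
  have 4: "integrable M (\<lambda>\<omega>. letter j (Z \<omega>)) \<and> (\<integral>\<omega>. letter j (Z \<omega>) \<partial>M) = 0"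
    if "j = (True, True, True)"
    by (rule integral_Complex_zero[of _ "\<lambda>\<omega>. r * r * r * (h \<omega> ^ 3 + h \<omega> * l \<omega> ^ 2)" "\<lambda>\<omega>. r * r * r * (h \<omega> ^ 2 * l \<omega> + l \<omega> ^ 3)"])
      (use that pr in \<open>auto simp: \<mu> \<mu>0 letter_def Z' algebra_simps power2_eq_square power3_eq_cube\<close>)
  show ?thesis using 1 2 3 4 assms(2) by (auto simp: centred_letters_def)
qed

end

lemma one_plus_power_le:
  fixes x :: real assumes "0 \<le> x"
  shows "(1 + x) ^ n \<le> 2 ^ n * (1 + x ^ n)"
proof -
  have "(1 + x) ^ n \<le> (2 * max 1 x) ^ n" using assms by (intro power_mono) auto
  also have "\<dots> = 2 ^ n * max 1 x ^ n" by (simp add: power_mult_distrib)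
  also have "\<dots> \<le> 2 ^ n * (1 + x ^ n)" using assms by (intro mult_left_mono) (auto simp: max_def)
  finally show ?thesis .
qed

lemma norm_centred_letter:
  assumes "j \<in> centred_letters"
  shows "(cmod (letter j z))\<^sup>2 \<le> 1 + cmod z ^ 6"
proof -
  define x where "x = cmod z"
  have "\<exists>d\<in>{1,2,3}. cmod (letter j z) = x ^ d"
    using assms by (auto simp: centred_letters_def letter_def norm_mult x_def power2_eq_square power3_eq_cube)
  then obtain d where d: "d \<in> {1,2,3::nat}" "cmod (letter j z) = x ^ d" by blast
  have "(x ^ d)\<^sup>2 \<le> 1 + x ^ 6"
  proof (cases "x \<le> 1")
    case True
    have "(x ^ d)\<^sup>2 \<le> 1" using True by (intro power_le_one) (auto simp: x_def)
    then show ?thesis by (simp add: x_def add_increasing2)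
  next
    case False
    have "(x ^ d)\<^sup>2 = x ^ (d * 2)" by (simp add: power_mult)
    also have "\<dots> \<le> x ^ 6" using False d by (intro power_increasing) auto
    finally show ?thesis by simp
  qed
  then show ?thesis by (simp add: d x_def)
qed

text \<open>
  The hypothesis of the tensorization lemma holds for the Gaussian letters, with weight \<open>1\<close> for the
  empty letter and one constant \<open>C\<close> for all the others, uniformly over all normalized complex
  Gaussians.
\<close>

lemma letter_smoothness:
  obtains C :: real where "C \<ge> 1"
    "\<And>(M :: 'a measure) Z f. prob_space M \<Longrightarrow> normalized_complex_gaussian M Z \<Longrightarrow>
      (\<integral>\<^sup>+x. ennreal (cmod (\<Sum>j\<in>insert no_letter centred_letters. f j * letter j x) ^ (2 * Suc k)) \<partial>distr M borel Z)
      \<le> ennreal ((\<Sum>j\<in>insert no_letter centred_letters. (if j = no_letter then 1 else C) * (cmod (f j))\<^sup>2) ^ Suc k)"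
proof -
  define \<nu> where "\<nu> = (\<lambda>n::nat. (2::real) ^ n * (2 * (\<integral>x. std_normal_density x * \<bar>x\<bar> ^ n \<partial>lborel)))"
  define c where "c = real (card centred_letters)"
  define m1 where "m1 = c * (1 + \<nu> 6)"
  define m2 where "m2 = c ^ Suc k * (2 ^ Suc k * (1 + \<nu> (6 * Suc k)))"
  obtain C :: real where C: "C \<ge> 1" and
    main: "\<And>(M :: 'a measure) W Q B z. prob_space M \<Longrightarrow> integrable M W \<Longrightarrow> (\<integral>x. W x \<partial>M) = 0 \<Longrightarrow>
       integrable M Q \<Longrightarrow> integrable M (\<lambda>x. Q x ^ Suc k) \<Longrightarrow>
       (\<integral>x. Q x \<partial>M) \<le> max m1 m2 \<Longrightarrow> (\<integral>x. Q x ^ Suc k \<partial>M) \<le> max m1 m2 \<Longrightarrow>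
       0 \<le> B \<Longrightarrow> (\<And>x. 0 \<le> Q x) \<Longrightarrow> (\<And>x. (cmod (W x))\<^sup>2 \<le> B * Q x) \<Longrightarrow>
       (\<integral>\<^sup>+x. ennreal (cmod (z + W x) ^ (2 * Suc k)) \<partial>M) \<le> ennreal (((cmod z)\<^sup>2 + C * B) ^ Suc k)"
    using centred_perturbation_moment[of k "max m1 m2", where 'b = 'a] by blast
  show ?thesis
  proof (rule that[OF C])
    fix M :: "'a measure" and Z :: "'a \<Rightarrow> complex" and f :: "bool \<times> bool \<times> bool \<Rightarrow> complex"
    assume M: "prob_space M" and Z: "normalized_complex_gaussian M Z"
    interpret prob_space M by fact
    note [measurable] = normalized_complex_gaussian_measurable[OF Z]
    have \<nu>: "2 ^ n * (2 * (\<integral>x. std_normal_density x * \<bar>x\<bar> ^ n \<partial>lborel)) = \<nu> n" for n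
      by (simp only: \<nu>_def)
    note mom = normalized_complex_gaussian_abs_moment[OF Z, unfolded \<nu>]
    define W where "W = (\<lambda>\<omega>. \<Sum>j\<in>centred_letters. f j * letter j (Z \<omega>))"
    define Q where "Q = (\<lambda>\<omega>. c * (1 + cmod (Z \<omega>) ^ 6))"
    define B where "B = (\<Sum>j\<in>centred_letters. (cmod (f j))\<^sup>2)"
    have c0: "c \<ge> 0" by (simp add: c_def)
    have iW: "integrable M W" unfolding W_def
      using centred_letter_mean[OF Z] by (intro Bochner_Integration.integrable_sum integrable_mult_right) auto
    have W0: "(\<integral>x. W x \<partial>M) = 0" unfolding W_def
      using centred_letter_mean[OF Z] by (subst Bochner_Integration.integral_sum) auto
    have iQ: "integrable M Q" unfolding Q_def using mom(1) by auto
    have mQ: "(\<integral>x. Q x \<partial>M) \<le> max m1 m2"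
    proof (intro max.coboundedI1)
      have "(\<integral>x. Q x \<partial>M) = c * (1 + (\<integral>x. cmod (Z x) ^ 6 \<partial>M))"
        unfolding Q_def using mom(1)[of 6] by (simp add: prob_space)
      also have "\<dots> \<le> m1"
        unfolding m1_def using mom(2)[of 6] c0 by (intro mult_left_mono add_left_mono)
      finally show "(\<integral>x. Q x \<partial>M) \<le> m1" .
    qed
    have Qk: "Q x ^ Suc k \<le> c ^ Suc k * (2 ^ Suc k * (1 + cmod (Z x) ^ (6 * Suc k)))" for x
      using one_plus_power_le[of "cmod (Z x) ^ 6" "Suc k"] c0
      unfolding Q_def power_mult_distrib by (intro mult_left_mono) (auto simp only: power_mult zero_le_power norm_ge_zero)
    have iR: "integrable M (\<lambda>x. c ^ Suc k * (2 ^ Suc k * (1 + cmod (Z x) ^ (6 * Suc k))))"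
      using mom(1)[of "6 * Suc k"] by (intro integrable_mult_right Bochner_Integration.integrable_add) auto
    have Q0: "0 \<le> Q x" for x by (simp add: Q_def c0)
    have iQk: "integrable M (\<lambda>x. Q x ^ Suc k)"
    proof (rule Bochner_Integration.integrable_bound[OF iR])
      show "(\<lambda>x. Q x ^ Suc k) \<in> borel_measurable M" unfolding Q_def by measurable
      show "AE x in M. norm (Q x ^ Suc k) \<le> norm (c ^ Suc k * (2 ^ Suc k * (1 + cmod (Z x) ^ (6 * Suc k))))"
        using Q0 Qk by (intro AE_I2) (metis real_norm_def abs_of_nonneg zero_le_power abs_ge_self order_trans)
    qed
    have "(\<integral>x. Q x ^ Suc k \<partial>M) \<le> (\<integral>x. c ^ Suc k * (2 ^ Suc k * (1 + cmod (Z x) ^ (6 * Suc k))) \<partial>M)"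
      by (intro integral_mono iQk iR Qk)
    also have "\<dots> = c ^ Suc k * (2 ^ Suc k * (1 + (\<integral>x. cmod (Z x) ^ (6 * Suc k) \<partial>M)))"
      using mom(1)[of "6 * Suc k"] by (simp add: prob_space del: mult_Suc_right power_Suc)
    also have "\<dots> \<le> m2" unfolding m2_def using mom(2)[of "6 * Suc k"] c0
      by (intro mult_left_mono add_left_mono) auto
    finally have mQk: "(\<integral>x. Q x ^ Suc k \<partial>M) \<le> max m1 m2" by simp
    have WQ: "(cmod (W x))\<^sup>2 \<le> B * Q x" for x
    proof -
      have "cmod (W x) \<le> (\<Sum>j\<in>centred_letters. cmod (f j) * cmod (letter j (Z x)))"
        unfolding W_def by (rule order_trans[OF norm_sum]) (simp add: norm_mult)
      then have "(cmod (W x))\<^sup>2 \<le> (\<Sum>j\<in>centred_letters. cmod (f j) * cmod (letter j (Z x)))\<^sup>2"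
        by (intro power_mono) auto
      also have "\<dots> \<le> B * (\<Sum>j\<in>centred_letters. (cmod (letter j (Z x)))\<^sup>2)"
        unfolding B_def by (rule Cauchy_Schwarz_ineq_sum)
      also have "\<dots> \<le> B * (\<Sum>j\<in>centred_letters. 1 + cmod (Z x) ^ 6)"
        by (intro mult_left_mono sum_mono norm_centred_letter) (auto simp: B_def sum_nonneg)
      also have "\<dots> = B * Q x" by (simp add: Q_def c_def)
      finally show ?thesis .
    qed
    have "(\<integral>\<^sup>+x. ennreal (cmod (\<Sum>j\<in>insert no_letter centred_letters. f j * letter j x) ^ (2 * Suc k)) \<partial>distr M borel Z)
        = (\<integral>\<^sup>+x. ennreal (cmod (f no_letter + W x) ^ (2 * Suc k)) \<partial>M)"
      by (subst nn_integral_distr) (auto simp: W_def)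
    also have "\<dots> \<le> ennreal (((cmod (f no_letter))\<^sup>2 + C * B) ^ Suc k)"
      by (rule main[OF M iW W0 iQ iQk mQ mQk _ Q0 WQ]) (simp add: B_def sum_nonneg)
    also have "(cmod (f no_letter))\<^sup>2 + C * B =
       (\<Sum>j\<in>insert no_letter centred_letters. (if j = no_letter then 1 else C) * (cmod (f j))\<^sup>2)"
      by (auto simp: B_def sum_distrib_left intro!: sum.cong)
    finally show "(\<integral>\<^sup>+x. ennreal (cmod (\<Sum>j\<in>insert no_letter centred_letters. f j * letter j x) ^ (2 * Suc k)) \<partial>distr M borel Z)
      \<le> ennreal ((\<Sum>j\<in>insert no_letter centred_letters. (if j = no_letter then 1 else C) * (cmod (f j))\<^sup>2) ^ Suc k)" .
  qed
qed

section \<open>Moments of cubic Gaussian forms\<close>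

definition bracket :: "int \<Rightarrow> real" where
  "bracket n = 1 + \<bar>real_of_int n\<bar>"

definition freq :: "int \<times> int \<times> int \<Rightarrow> int" where
  "freq = (\<lambda>(a, b, d). a - b + d)"

text \<open>
  The triples that survive after subtracting \<open>2 \<parallel>u\<parallel>\<^sup>2 u\<close>: those in which the conjugated
  frequency \<open>b\<close> meets neither of the others, together with the diagonal ones. The latter are counted in
  both of the removed pairings \<open>a = b\<close> and \<open>b = d\<close>, so they remain with the sign \<open>-1\<close>; this is
  the sign in the definition of \<open>cubic_term\<close>.
\<close>

definition unpaired_triples :: "(int \<times> int \<times> int) set" where
  "unpaired_triples = {(a, b, d). b \<noteq> a \<and> b \<noteq> d \<or> a = b \<and> b = d}"

definition cubic_term :: "(int \<Rightarrow> complex) \<Rightarrow> int \<times> int \<times> int \<Rightarrow> complex" where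
  "cubic_term c = (\<lambda>(a, b, d). (if a = b then - 1 else 1) * (c a * cnj (c b) * c d))"

definition triple_weight :: "int \<times> int \<times> int \<Rightarrow> real" where
  "triple_weight = (\<lambda>(a, b, d). 1 / (bracket a * bracket b * bracket d))"

lemma bracket_ge_1: "1 \<le> bracket n" and bracket_pos: "0 < bracket n" and bracket_ge_0: "0 \<le> bracket n"
  by (simp_all add: bracket_def)

lemma triple_weight_nonneg: "0 \<le> triple_weight t"
  by (cases t) (simp add: triple_weight_def bracket_ge_0)

definition triple_letters :: "int \<times> int \<times> int \<Rightarrow> int \<Rightarrow> bool \<times> bool \<times> bool" where
  "triple_letters = (\<lambda>(a, b, d) i. (i = a, i = b, i = d))"

lemma prod_letters:
  assumes "finite I" "a \<in> I" "b \<in> I" "d \<in> I"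
  shows "(\<Prod>i\<in>I. letter (triple_letters (a, b, d) i) (x i)) = x a * cnj (x b) * x d"
  using assms by (simp add: letter_def triple_letters_def prod.distrib)

lemma prod_letter_constants:
  assumes "finite I" "1 \<le> (C :: real)"
  shows "(\<Prod>i\<in>I. if triple_letters t i = no_letter then 1 else C) \<le> C ^ 3"
proof -
  obtain a b d where t: "t = (a, b, d)" by (cases t)
  have "(\<Prod>i\<in>I. if triple_letters t i = no_letter then 1 else C) = (\<Prod>i\<in>I \<inter> {a, b, d}. C)"
    using assms(1) by (intro prod.mono_neutral_cong_right) (auto simp: t triple_letters_def no_letter_def)
  also have "\<dots> = C ^ card (I \<inter> {a, b, d})" by simp
  also have "\<dots> \<le> C ^ 3"
  proof (rule power_increasing[OF _ assms(2)])
    have "card (I \<inter> {a, b, d}) \<le> card {a, b, d}" by (intro card_mono) auto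
    also have "\<dots> \<le> 3" by (simp add: card_insert_if)
    finally show "card (I \<inter> {a, b, d}) \<le> 3" .
  qed
  finally show ?thesis .
qed

text \<open>
  Hypercontractivity for the cubic Gaussian sums: every even moment is bounded by the corresponding
  power of the sum of the squares of the coefficients. An unpaired triple \<open>(a, b, d)\<close> is a word with at
  most three nonempty letters, all of them centred, and it is determined by that word; so the
  tensorization lemma applies with constant \<open>C\<^sup>3\<close>.
\<close>

lemma cubic_term_sum_moment:
  fixes P :: "'a measure" and g :: "int \<Rightarrow> 'a \<Rightarrow> complex"
  assumes P: "prob_space P" and indep: "prob_space.indep_vars P (\<lambda>_. borel) g UNIV"
    and gauss: "\<And>n. normalized_complex_gaussian P (g n)"
  obtains K :: real where "K \<ge> 0"
    "\<And>B. finite B \<Longrightarrow> B \<subseteq> unpaired_triples \<Longrightarrow>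
      (\<integral>\<^sup>+\<omega>. ennreal (cmod (\<Sum>t\<in>B. cubic_term (\<lambda>n. g n \<omega> / of_real (bracket n powr (1 / 2))) t) ^ (2 * Suc k)) \<partial>P)
        \<le> ennreal ((K * (\<Sum>t\<in>B. triple_weight t)) ^ Suc k)"
proof -
  interpret prob_space P by fact
  obtain C :: real where C: "C \<ge> 1" and smooth:
    "\<And>(M :: 'a measure) Z f. prob_space M \<Longrightarrow> normalized_complex_gaussian M Z \<Longrightarrow>
      (\<integral>\<^sup>+x. ennreal (cmod (\<Sum>j\<in>insert no_letter centred_letters. f j * letter j x) ^ (2 * Suc k)) \<partial>distr M borel Z)
      \<le> ennreal ((\<Sum>j\<in>insert no_letter centred_letters. (if j = no_letter then 1 else C) * (cmod (f j))\<^sup>2) ^ Suc k)"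
    using letter_smoothness[of k, where 'a = 'a] by blast
  show ?thesis
  proof (rule that[of "C ^ 3"])
    show "C ^ 3 \<ge> 0" using C by simp
    fix B :: "(int \<times> int \<times> int) set" assume B: "finite B" "B \<subseteq> unpaired_triples"
    define I where "I = insert 0 (\<Union>(a, b, d)\<in>B. {a, b, d})"
    have I: "finite I" "I \<noteq> {}" using B by (auto simp: I_def)
    have inI: "a \<in> I" "b \<in> I" "d \<in> I" if "(a, b, d) \<in> B" for a b d
      using that by (auto simp: I_def)
    define \<gamma> where "\<gamma> = (\<lambda>i. distr P borel (g i))"
    have meas [measurable]: "g i \<in> borel_measurable P" for i
      by (rule normalized_complex_gaussian_measurable[OF gauss])
    have \<gamma>: "prob_space (\<gamma> i)" for i unfolding \<gamma>_def by (intro prob_space_distr meas)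
    have sets_\<gamma>: "sets (Pi\<^sub>M I \<gamma>) = sets (Pi\<^sub>M I (\<lambda>_. borel))"
      by (intro sets_PiM_cong) (auto simp: \<gamma>_def)
    define s where "s = (\<lambda>n. complex_of_real (bracket n powr (1 / 2)))"
    define \<alpha> where "\<alpha> = (\<lambda>(a, b, d). (if a = b then - 1 else 1) / (s a * s b * s d))"
    define F where "F = (\<lambda>x. \<Sum>t\<in>B. \<alpha> t * (\<Prod>i\<in>I. letter (triple_letters t i) (x i)))"
    have \<alpha>: "(cmod (\<alpha> t))\<^sup>2 = triple_weight t" for t
    proof -
      have "(bracket n powr (1 / 2))\<^sup>2 = bracket n" for n
        using bracket_pos[of n] by (simp add: powr_power)
      then show ?thesis
        by (cases t) (simp add: \<alpha>_def triple_weight_def s_def norm_mult norm_divide power_mult_distrib power_divide)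
    qed
    have cubic_eq: "cubic_term (\<lambda>n. x n / s n) t = \<alpha> t * (\<Prod>i\<in>I. letter (triple_letters t i) (x i))"
      if "t \<in> B" for t x
    proof -
      obtain a b d where t: "t = (a, b, d)" by (cases t)
      have "cnj (s n) = s n" for n by (simp add: s_def)
      then show ?thesis using that prod_letters[OF I(1) inI[of a b d], of x]
        by (simp add: t cubic_term_def \<alpha>_def)
    qed
    have measF: "(\<lambda>x. ennreal (cmod (F x) ^ (2 * Suc k))) \<in> borel_measurable (Pi\<^sub>M I (\<lambda>_. borel))"
    proof -
      have "(\<lambda>x. letter j (x i)) \<in> borel_measurable (Pi\<^sub>M I (\<lambda>_. borel))" if "i \<in> I" for i j
        using that by measurable
      then have [measurable]: "F \<in> borel_measurable (Pi\<^sub>M I (\<lambda>_. borel))"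
        unfolding F_def by (intro borel_measurable_sum borel_measurable_times borel_measurable_prod) auto
      show ?thesis by measurable
    qed
    have TJ: "triple_letters t i \<in> insert no_letter centred_letters" if "t \<in> B" for t i
      using that B(2) by (auto simp: triple_letters_def no_letter_def centred_letters_def unpaired_triples_def)
    have inj: "inj_on (\<lambda>t. restrict (triple_letters t) I) B"
    proof (rule inj_onI)
      fix t t' assume t: "t \<in> B" "t' \<in> B" and eq: "restrict (triple_letters t) I = restrict (triple_letters t') I"
      obtain a b d a' b' d' where tt: "t = (a, b, d)" "t' = (a', b', d')" by (cases t; cases t')
      have "triple_letters t i = triple_letters t' i" if "i \<in> I" for i
        using fun_cong[OF eq, of i] that by simp
      \<comment> \<open>The flag set at the index \<open>a\<close> in the first word must be set in the second one as well.\<close>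
      from this[of a] this[of b] this[of d] show "t = t'"
        using inI[of a b d] t by (auto simp: tt triple_letters_def)
    qed
    have "(\<integral>\<^sup>+\<omega>. ennreal (cmod (\<Sum>t\<in>B. cubic_term (\<lambda>n. g n \<omega> / of_real (bracket n powr (1 / 2))) t) ^ (2 * Suc k)) \<partial>P)
       = (\<integral>\<^sup>+\<omega>. ennreal (cmod (F (\<lambda>i\<in>I. g i \<omega>)) ^ (2 * Suc k)) \<partial>P)"
    proof (intro nn_integral_cong)
      fix \<omega>
      have "(\<Sum>t\<in>B. cubic_term (\<lambda>n. g n \<omega> / of_real (bracket n powr (1 / 2))) t) = F (\<lambda>i\<in>I. g i \<omega>)"
        unfolding F_def
      proof (intro sum.cong refl)
        fix t assume t: "t \<in> B"
        have "cubic_term (\<lambda>n. g n \<omega> / s n) t = \<alpha> t * (\<Prod>i\<in>I. letter (triple_letters t i) (g i \<omega>))"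
          by (rule cubic_eq[OF t])
        then show "cubic_term (\<lambda>n. g n \<omega> / complex_of_real (bracket n powr (1 / 2))) t =
            \<alpha> t * (\<Prod>i\<in>I. letter (triple_letters t i) ((\<lambda>i\<in>I. g i \<omega>) i))"
          by (simp add: s_def)
      qed
      then show "ennreal (cmod (\<Sum>t\<in>B. cubic_term (\<lambda>n. g n \<omega> / of_real (bracket n powr (1 / 2))) t) ^ (2 * Suc k))
          = ennreal (cmod (F (\<lambda>i\<in>I. g i \<omega>)) ^ (2 * Suc k))" by simp
    qed
    also have "\<dots> = (\<integral>\<^sup>+x. ennreal (cmod (F x) ^ (2 * Suc k)) \<partial>distr P (Pi\<^sub>M I (\<lambda>_. borel)) (\<lambda>\<omega>. \<lambda>i\<in>I. g i \<omega>))"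
      by (subst nn_integral_distr) (use measF in \<open>auto intro!: measurable_restrict\<close>)
    also have "distr P (Pi\<^sub>M I (\<lambda>_. borel)) (\<lambda>\<omega>. \<lambda>i\<in>I. g i \<omega>) = Pi\<^sub>M I \<gamma>"
      unfolding \<gamma>_def
      using indep_vars_iff_distr_eq_PiM[where M' = "\<lambda>_. borel" and X = g, OF I(2) meas] indep_vars_subset[OF indep, of I] by simp
    also have "(\<integral>\<^sup>+x. ennreal (cmod (F x) ^ (2 * Suc k)) \<partial>Pi\<^sub>M I \<gamma>)
        \<le> ennreal ((\<Sum>t\<in>B. (cmod (\<alpha> t))\<^sup>2 * (\<Prod>i\<in>I. if triple_letters t i = no_letter then 1 else C)) ^ Suc k)"
      unfolding F_def
    proof (rule hypercontractive_tensorization[where J = "insert no_letter centred_letters"])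
      show "(\<integral>\<^sup>+x. ennreal (cmod (\<Sum>j\<in>insert no_letter centred_letters. f j * letter j x) ^ (2 * Suc k)) \<partial>\<gamma> i)
        \<le> ennreal ((\<Sum>j\<in>insert no_letter centred_letters. (if j = no_letter then 1 else C) * (cmod (f j))\<^sup>2) ^ Suc k)" for i f
        unfolding \<gamma>_def by (rule smooth[OF P gauss])
      show "letter j \<in> borel_measurable (\<gamma> i)" for i j unfolding \<gamma>_def by simp
    qed (use \<gamma> I B TJ inj C in auto)
    also have "\<dots> \<le> ennreal ((C ^ 3 * (\<Sum>t\<in>B. triple_weight t)) ^ Suc k)"
    proof (intro ennreal_leI power_mono)
      have "(\<Sum>t\<in>B. (cmod (\<alpha> t))\<^sup>2 * (\<Prod>i\<in>I. if triple_letters t i = no_letter then 1 else C))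
          \<le> (\<Sum>t\<in>B. triple_weight t * C ^ 3)"
        unfolding \<alpha> using triple_weight_nonneg by (intro sum_mono mult_left_mono prod_letter_constants I C) auto
      then show "(\<Sum>t\<in>B. (cmod (\<alpha> t))\<^sup>2 * (\<Prod>i\<in>I. if triple_letters t i = no_letter then 1 else C))
          \<le> C ^ 3 * (\<Sum>t\<in>B. triple_weight t)"
        by (simp add: sum_distrib_right[symmetric] mult.commute)
      show "0 \<le> (\<Sum>t\<in>B. (cmod (\<alpha> t))\<^sup>2 * (\<Prod>i\<in>I. if triple_letters t i = no_letter then 1 else C))"
        using C by (intro sum_nonneg mult_nonneg_nonneg prod_nonneg) auto
    qed
    finally show "(\<integral>\<^sup>+\<omega>. ennreal (cmod (\<Sum>t\<in>B. cubic_term (\<lambda>n. g n \<omega> / of_real (bracket n powr (1 / 2))) t) ^ (2 * Suc k)) \<partial>P)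
        \<le> ennreal ((C ^ 3 * (\<Sum>t\<in>B. triple_weight t)) ^ Suc k)" .
  qed
qed

text \<open>
  Moments of a weighted \<open>\<ell>\<^sup>2\<close> norm over the output frequencies, by one more application of
  Minkowski's inequality.
\<close>

lemma weighted_cubic_moment:
  fixes P :: "'a measure" and g :: "int \<Rightarrow> 'a \<Rightarrow> complex"
  assumes P: "prob_space P" and indep: "prob_space.indep_vars P (\<lambda>_. borel) g UNIV"
    and gauss: "\<And>n. normalized_complex_gaussian P (g n)"
  obtains K :: real where "K \<ge> 0"
    "\<And>B S w. finite B \<Longrightarrow> B \<subseteq> unpaired_triples \<Longrightarrow> finite S \<Longrightarrow> freq ` B \<subseteq> S \<Longrightarrow> (\<And>n. 0 \<le> w n) \<Longrightarrow>
      (\<integral>\<^sup>+\<omega>. ennreal ((\<Sum>n\<in>S. w n *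
          (cmod (\<Sum>t\<in>{t \<in> B. freq t = n}. cubic_term (\<lambda>n. g n \<omega> / of_real (bracket n powr (1 / 2))) t))\<^sup>2) ^ Suc k) \<partial>P)
        \<le> ennreal ((K * (\<Sum>t\<in>B. w (freq t) * triple_weight t)) ^ Suc k)"
proof -
  interpret prob_space P by fact
  have meas [measurable]: "g i \<in> borel_measurable P" for i
    by (rule normalized_complex_gaussian_measurable[OF gauss])
  obtain K :: real where K: "K \<ge> 0" and mom: "\<And>B. finite B \<Longrightarrow> B \<subseteq> unpaired_triples \<Longrightarrow>
      (\<integral>\<^sup>+\<omega>. ennreal (cmod (\<Sum>t\<in>B. cubic_term (\<lambda>n. g n \<omega> / of_real (bracket n powr (1 / 2))) t) ^ (2 * Suc k)) \<partial>P)
        \<le> ennreal ((K * (\<Sum>t\<in>B. triple_weight t)) ^ Suc k)"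
    using cubic_term_sum_moment[OF P indep gauss, of k] by blast
  show ?thesis
  proof (rule that[OF K])
    fix B :: "(int \<times> int \<times> int) set" and S :: "int set" and w :: "int \<Rightarrow> real"
    assume B: "finite B" "B \<subseteq> unpaired_triples" and S: "finite S" "freq ` B \<subseteq> S" and w: "\<And>n. 0 \<le> w n"
    define Bn where "Bn = (\<lambda>n. {t \<in> B. freq t = n})"
    define F where "F = (\<lambda>n \<omega>. \<Sum>t\<in>Bn n. cubic_term (\<lambda>n. g n \<omega> / of_real (bracket n powr (1 / 2))) t)"
    have Bn: "finite (Bn n)" "Bn n \<subseteq> unpaired_triples" for n using B by (auto simp: Bn_def)
    have cnj_meas: "cnj \<in> borel_measurable borel"
      by (intro borel_measurable_continuous_onI continuous_intros)
    have [measurable]: "F n \<in> borel_measurable P" for n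
      unfolding F_def cubic_term_def split_beta
      by (intro borel_measurable_sum borel_measurable_times borel_measurable_const
          measurable_compose[OF _ cnj_meas] borel_measurable_divide meas)
    have "(\<integral>\<^sup>+\<omega>. ennreal ((\<Sum>n\<in>S. w n * (cmod (F n \<omega>))\<^sup>2) ^ Suc k) \<partial>P)
        \<le> ennreal ((\<Sum>n\<in>S. w n * (K * (\<Sum>t\<in>Bn n. triple_weight t))) ^ Suc k)"
    proof (rule nn_integral_power_sum_le[OF S(1)])
      show "(\<integral>\<^sup>+\<omega>. ennreal (((cmod (F n \<omega>))\<^sup>2) ^ Suc k) \<partial>P)
          \<le> ennreal ((K * (\<Sum>t\<in>Bn n. triple_weight t)) ^ Suc k)" for n
        using mom[OF Bn] unfolding F_def power_mult .
    qed (use w K in \<open>auto intro!: mult_nonneg_nonneg sum_nonneg triple_weight_nonneg\<close>)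
    also have "(\<Sum>n\<in>S. w n * (K * (\<Sum>t\<in>Bn n. triple_weight t))) = K * (\<Sum>t\<in>B. w (freq t) * triple_weight t)"
      unfolding sum.group[OF B(1) S, of "\<lambda>t. w (freq t) * triple_weight t", symmetric] sum_distrib_left
      by (intro sum.cong refl) (auto simp: Bn_def)
    finally show "(\<integral>\<^sup>+\<omega>. ennreal ((\<Sum>n\<in>S. w n *
          (cmod (\<Sum>t\<in>{t \<in> B. freq t = n}. cubic_term (\<lambda>n. g n \<omega> / of_real (bracket n powr (1 / 2))) t))\<^sup>2) ^ Suc k) \<partial>P)
        \<le> ennreal ((K * (\<Sum>t\<in>B. w (freq t) * triple_weight t)) ^ Suc k)"
      unfolding F_def Bn_def .
  qed
qed

section \<open>Decay of the sum over interacting frequencies\<close>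

lemma bracket_powr_sum_bounded:
  fixes s :: real assumes "s < - 1"
  obtains H where "H \<ge> 0" "\<And>A. finite A \<Longrightarrow> (\<Sum>n\<in>A. bracket n powr s) \<le> H"
proof -
  have "summable (\<lambda>j. real (Suc j) powr s)"
    using assms by (subst summable_Suc_iff) (simp add: summable_real_powr_iff)
  then have sm: "(\<Sum>j\<in>D. real (Suc j) powr s) \<le> (\<Sum>j. real (Suc j) powr s)" if "finite D" for D
    using that by (intro sum_le_suminf) auto
  define H where "H = (\<Sum>j. real (Suc j) powr s)"
  have part: "(\<Sum>n\<in>A. bracket n powr s) \<le> H" if A: "finite A" "inj_on (\<lambda>n. nat \<bar>n\<bar>) A" for A
  proof -
    have "(\<Sum>n\<in>A. bracket n powr s) = (\<Sum>j\<in>(\<lambda>n. nat \<bar>n\<bar>) ` A. real (Suc j) powr s)"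
      by (subst sum.reindex[OF A(2)]) (auto intro!: sum.cong simp: bracket_def)
    also have "\<dots> \<le> H" unfolding H_def using A by (intro sm) auto
    finally show ?thesis .
  qed
  show ?thesis
  proof (rule that[of "H + H"])
    show "H + H \<ge> 0" using part[of "{}"] by simp
    fix A :: "int set" assume A: "finite A"
    have "(\<Sum>n\<in>A. bracket n powr s) = (\<Sum>n\<in>A \<inter> {0..}. bracket n powr s) + (\<Sum>n\<in>A \<inter> {..<0}. bracket n powr s)"
      using A by (subst sum.union_disjoint[symmetric]) (auto intro!: sum.cong)
    also have "\<dots> \<le> H + H" using A by (intro add_mono part) (auto simp: inj_on_def)
    finally show "(\<Sum>n\<in>A. bracket n powr s) \<le> H + H" .
  qed
qed

lemma sum_triple_product_le:
  fixes h :: "int \<Rightarrow> real"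
  assumes h: "\<And>n. 0 \<le> h n" and H: "\<And>A. finite A \<Longrightarrow> sum h A \<le> H"
    and B: "finite B" "inj_on (\<lambda>t. (p t, q t, r t)) B"
  shows "(\<Sum>t\<in>B. h (p t) * h (q t) * h (r t)) \<le> H ^ 3"
proof -
  define A where "A = p ` B \<union> q ` B \<union> r ` B"
  have A: "finite A" using B by (simp add: A_def)
  have "(\<Sum>t\<in>B. h (p t) * h (q t) * h (r t)) =
      (\<Sum>(x, y, z)\<in>(\<lambda>t. (p t, q t, r t)) ` B. h x * h y * h z)"
    by (subst sum.reindex[OF B(2)]) simp
  also have "\<dots> \<le> (\<Sum>(x, y, z)\<in>A \<times> A \<times> A. h x * h y * h z)"
    using A h by (intro sum_mono2) (auto simp: A_def)
  also have "\<dots> = sum h A * sum h A * sum h A"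
    by (simp only: sum.cartesian_product[symmetric] sum_distrib_left[symmetric] sum_distrib_right[symmetric] mult.assoc)
  also have "\<dots> \<le> H * H * H"
    using H[OF A] h sum_nonneg[of A h] by (intro mult_mono) auto
  finally show ?thesis by (simp add: power3_eq_cube)
qed

lemma largest_bracket_powr:
  fixes x y z w \<epsilon> :: real
  assumes "0 \<le> \<epsilon>" "1 \<le> x" "1 \<le> y" "1 \<le> z" "1 \<le> w" "y \<le> x" "z \<le> x" "w \<le> x"
  shows "x powr (- 4 * \<epsilon>) \<le> x powr (- \<epsilon>) * (y powr (- \<epsilon>) * z powr (- \<epsilon>) * w powr (- \<epsilon>))"
proof -
  have "x powr (- 4 * \<epsilon>) = x powr (- \<epsilon> + (- \<epsilon> + - \<epsilon> + - \<epsilon>))" by simp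
  also have "\<dots> = x powr (- \<epsilon>) * (x powr (- \<epsilon>) * x powr (- \<epsilon>) * x powr (- \<epsilon>))"
    by (simp only: powr_add)
  also have "\<dots> \<le> x powr (- \<epsilon>) * (y powr (- \<epsilon>) * z powr (- \<epsilon>) * w powr (- \<epsilon>))"
    using assms by (intro mult_left_mono mult_mono powr_mono2') auto
  finally show ?thesis .
qed

text \<open>
  Whichever of the four variables is the largest, it can be traded for decay of the other three.
  If it is \<open>n\<close>, its factor of exponent \<open>-4 \<epsilon>\<close> is split evenly between \<open>L\<close> and the other
  three variables. If it is one of the others, then its factor of exponent \<open>-1\<close> first strengthens
  the exponent of \<open>n\<close> from \<open>-4 \<epsilon>\<close> to \<open>-1\<close>, and the remaining \<open>-4 \<epsilon>\<close> is split in the same way.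
  The result is summable in the three variables that are left.
\<close>

lemma product_weight_bound:
  fixes n a b d L \<epsilon> :: real
  assumes \<epsilon>: "0 < \<epsilon>" "4 * \<epsilon> \<le> 1"
    and ge1: "1 \<le> n" "1 \<le> a" "1 \<le> b" "1 \<le> d" "1 \<le> L"
    and L: "L \<le> n \<or> L \<le> a \<or> L \<le> b \<or> L \<le> d"
  defines "h \<equiv> \<lambda>x. x powr (- 1 - \<epsilon>)"
  shows "n powr (- 4 * \<epsilon>) * (1 / (a * b * d))
     \<le> L powr (- \<epsilon>) * (h a * h b * h d + h n * h b * h d + h n * h a * h d + h n * h a * h b)"
proof -
  have h: "h x = x powr (- \<epsilon>) * (1 / x)" if "1 \<le> x" for x
    using that unfolding h_def by (simp add: powr_diff powr_minus_divide)
  have h0: "0 \<le> h x" for x by (simp add: h_def)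
  \<comment> \<open>The variable to be discarded.\<close>
  define M where "M = max n (max a (max b d))"
  have Mx: "n \<le> M" "a \<le> M" "b \<le> M" "d \<le> M" "L \<le> M" "1 \<le> M" using L ge1 by (auto simp: M_def)
  have decay: "M powr (- \<epsilon>) \<le> L powr (- \<epsilon>)" using ge1 \<epsilon> Mx by (intro powr_mono2') auto
  have others_largest: "n powr (- 4 * \<epsilon>) * (1 / (M * y * z)) \<le> M powr (- \<epsilon>) * (h n * h y * h z)"
    if yz: "1 \<le> y" "1 \<le> z" "y \<le> M" "z \<le> M" for y z
  proof -
    have "1 / M = M powr (- (1 - 4 * \<epsilon>)) * M powr (- 4 * \<epsilon>)"
    proof -
      have "M powr (- (1 - 4 * \<epsilon>)) * M powr (- 4 * \<epsilon>) = M powr (- 1)"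
        by (simp only: powr_add[symmetric]) simp
      then show ?thesis using Mx by (simp add: powr_minus_divide)
    qed
    also have "\<dots> \<le> n powr (- (1 - 4 * \<epsilon>)) * (M powr (- \<epsilon>) * (n powr (- \<epsilon>) * y powr (- \<epsilon>) * z powr (- \<epsilon>)))"
      using Mx ge1 \<epsilon> yz by (intro mult_mono powr_mono2' largest_bracket_powr) auto
    finally have "n powr (- 4 * \<epsilon>) * (1 / M) \<le> n powr (- 4 * \<epsilon>) * (n powr (- (1 - 4 * \<epsilon>)) *
        (M powr (- \<epsilon>) * (n powr (- \<epsilon>) * y powr (- \<epsilon>) * z powr (- \<epsilon>))))"
      by (intro mult_left_mono) auto
    also have "\<dots> = (n powr (- 4 * \<epsilon>) * n powr (- (1 - 4 * \<epsilon>))) *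
        (M powr (- \<epsilon>) * (n powr (- \<epsilon>) * y powr (- \<epsilon>) * z powr (- \<epsilon>)))" by (simp only: mult_ac)
    also have "n powr (- 4 * \<epsilon>) * n powr (- (1 - 4 * \<epsilon>)) = 1 / n"
    proof -
      have "n powr (- 4 * \<epsilon>) * n powr (- (1 - 4 * \<epsilon>)) = n powr (- 1)"
        by (simp only: powr_add[symmetric]) simp
      then show ?thesis using ge1 by (simp add: powr_minus_divide)
    qed
    finally have "n powr (- 4 * \<epsilon>) * (1 / M) * (1 / (y * z)) \<le>
        1 / n * (M powr (- \<epsilon>) * (n powr (- \<epsilon>) * y powr (- \<epsilon>) * z powr (- \<epsilon>))) * (1 / (y * z))"
      using yz by (intro mult_right_mono) auto
    moreover have "n powr (- 4 * \<epsilon>) * (1 / M) * (1 / (y * z)) = n powr (- 4 * \<epsilon>) * (1 / (M * y * z))"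
      by simp
    moreover have "1 / n * (M powr (- \<epsilon>) * (n powr (- \<epsilon>) * y powr (- \<epsilon>) * z powr (- \<epsilon>))) * (1 / (y * z))
        = M powr (- \<epsilon>) * (h n * h y * h z)"
      unfolding h[OF yz(1)] h[OF yz(2)] h[OF ge1(1)] by simp
    ultimately show ?thesis by metis
  qed
  have freq_largest: "M powr (- 4 * \<epsilon>) * (1 / (a * b * d)) \<le> M powr (- \<epsilon>) * (h a * h b * h d)"
  proof -
    have "M powr (- 4 * \<epsilon>) * (1 / (a * b * d)) \<le> M powr (- \<epsilon>) * (a powr (- \<epsilon>) * b powr (- \<epsilon>) * d powr (- \<epsilon>)) * (1 / (a * b * d))"
      using Mx ge1 \<epsilon> by (intro mult_right_mono largest_bracket_powr) auto
    also have "\<dots> = M powr (- \<epsilon>) * (h a * h b * h d)"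
      unfolding h[OF ge1(2)] h[OF ge1(3)] h[OF ge1(4)] by simp
    finally show ?thesis .
  qed
  define S where "S = h a * h b * h d + h n * h b * h d + h n * h a * h d + h n * h a * h b"
  have nn: "0 \<le> h u * h v * h w" for u v w using h0 by simp
  have S: "h a * h b * h d \<le> S" "h n * h b * h d \<le> S" "h n * h a * h d \<le> S" "h n * h a * h b \<le> S"
    using nn[of a b d] nn[of n b d] nn[of n a d] nn[of n a b] unfolding S_def by (simp_all add: add_increasing add_increasing2)
  have "M = n \<or> M = a \<or> M = b \<or> M = d" by (auto simp: M_def max_def)
  then have "n powr (- 4 * \<epsilon>) * (1 / (a * b * d)) \<le> M powr (- \<epsilon>) * S"
  proof (elim disjE)
    assume "M = n"
    then show ?thesis using order_trans[OF freq_largest mult_left_mono[OF S(1), of "M powr (- \<epsilon>)"]] by simp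
  next
    assume "M = a"
    then show ?thesis using order_trans[OF others_largest[of b d] mult_left_mono[OF S(2), of "M powr (- \<epsilon>)"]] ge1 Mx by simp
  next
    assume "M = b"
    then have eq: "a * b * d = M * a * d" by simp
    show ?thesis unfolding eq using order_trans[OF others_largest[of a d] mult_left_mono[OF S(3), of "M powr (- \<epsilon>)"]] ge1 Mx by simp
  next
    assume "M = d"
    then have eq: "a * b * d = M * a * b" by simp
    show ?thesis unfolding eq using order_trans[OF others_largest[of a b] mult_left_mono[OF S(4), of "M powr (- \<epsilon>)"]] ge1 Mx by simp
  qed
  also have "\<dots> \<le> L powr (- \<epsilon>) * S"
    using decay nn unfolding S_def by (intro mult_right_mono add_nonneg_nonneg) auto
  finally show ?thesis unfolding S_def .
qed

lemma sobolev_weight_le: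
  assumes "0 < \<sigma>" "4 * \<epsilon> \<le> 2 * \<sigma>"
  shows "(1 + (real_of_int n)\<^sup>2) powr (- \<sigma>) \<le> 2 powr \<sigma> * bracket n powr (- 4 * \<epsilon>)"
proof -
  have "(bracket n)\<^sup>2 \<le> 2 * (1 + (real_of_int n)\<^sup>2)"
    using sum_squares_bound[of 1 "\<bar>real_of_int n\<bar>"] by (simp add: bracket_def power2_sum)
  then have "(1 + (real_of_int n)\<^sup>2) powr (- \<sigma>) \<le> ((bracket n)\<^sup>2 / 2) powr (- \<sigma>)"
    using assms bracket_pos[of n] by (intro powr_mono2') auto
  also have "\<dots> = 2 powr \<sigma> * bracket n powr (- 2 * \<sigma>)"
  proof -
    have "(bracket n)\<^sup>2 powr (- \<sigma>) = bracket n powr (- 2 * \<sigma>)"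
      using powr_powr[of "bracket n" 2 "- \<sigma>"] bracket_pos[of n] by simp
    then show ?thesis by (simp add: powr_divide powr_minus_divide)
  qed
  also have "\<dots> \<le> 2 powr \<sigma> * bracket n powr (- 4 * \<epsilon>)"
    using assms bracket_ge_1[of n] by (intro mult_left_mono powr_mono) auto
  finally show ?thesis .
qed

text \<open>
  The counting estimate. The frequencies \<open>n = a - b + d\<close>, \<open>a\<close>, \<open>b\<close>, \<open>d\<close> satisfy one linear relation,
  so any three of them determine the triple; whichever one is discarded as the largest, the sum is over
  three free integers with summable weights. The restriction that some frequency is at least \<open>L\<close> produces
  the decay.
\<close>

lemma triple_sum_decay:
  assumes \<sigma>: "0 < \<sigma>"
  obtains \<epsilon> C :: real where "0 < \<epsilon>" "0 \<le> C"
    "\<And>B L. finite B \<Longrightarrow> 1 \<le> L \<Longrightarrow>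
      (\<And>a b d. (a, b, d) \<in> B \<Longrightarrow> L \<le> bracket (a - b + d) \<or> L \<le> bracket a \<or> L \<le> bracket b \<or> L \<le> bracket d) \<Longrightarrow>
      (\<Sum>t\<in>B. (1 + (real_of_int (freq t))\<^sup>2) powr (- \<sigma>) * triple_weight t) \<le> C * L powr (- \<epsilon>)"
proof -
  \<comment> \<open>The trade between the largest factor and the others wants \<open>4 \<epsilon> \<le> 1\<close>; one quarter of the available
    exponent goes to each of the four factors.\<close>
  define \<epsilon> where "\<epsilon> = min (2 * \<sigma>) 1 / 4"
  have \<epsilon>: "0 < \<epsilon>" "4 * \<epsilon> \<le> 1" "4 * \<epsilon> \<le> 2 * \<sigma>" using \<sigma> by (auto simp: \<epsilon>_def)
  define h where "h = (\<lambda>n. bracket n powr (- 1 - \<epsilon>))"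
  obtain H where H: "H \<ge> 0" "\<And>A. finite A \<Longrightarrow> (\<Sum>n\<in>A. h n) \<le> H"
    using bracket_powr_sum_bounded[of "- 1 - \<epsilon>"] \<epsilon> unfolding h_def by auto
  show ?thesis
  proof (rule that[OF \<epsilon>(1), of "2 powr \<sigma> * (4 * H ^ 3)"])
    show "0 \<le> 2 powr \<sigma> * (4 * H ^ 3)" using H by simp
    fix B :: "(int \<times> int \<times> int) set" and L :: real
    assume B: "finite B" and L: "1 \<le> L" and large: "\<And>a b d. (a, b, d) \<in> B \<Longrightarrow>
      L \<le> bracket (a - b + d) \<or> L \<le> bracket a \<or> L \<le> bracket b \<or> L \<le> bracket d"
    define a b d where "a = (\<lambda>t :: int \<times> int \<times> int. fst t)" and "b = (\<lambda>t :: int \<times> int \<times> int. fst (snd t))"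
      and "d = (\<lambda>t :: int \<times> int \<times> int. snd (snd t))"
    have fr: "freq t = a t - b t + d t" for t by (simp add: freq_def a_def b_def d_def split_beta)
    have "(1 + (real_of_int (freq t))\<^sup>2) powr (- \<sigma>) * triple_weight t
       \<le> 2 powr \<sigma> * (L powr (- \<epsilon>) * (h (a t) * h (b t) * h (d t) + h (freq t) * h (b t) * h (d t)
           + h (freq t) * h (a t) * h (d t) + h (freq t) * h (a t) * h (b t)))" if "t \<in> B" for t
    proof -
      have "(1 + (real_of_int (freq t))\<^sup>2) powr (- \<sigma>) * triple_weight t
         \<le> (2 powr \<sigma> * bracket (freq t) powr (- 4 * \<epsilon>)) * triple_weight t"
        using \<sigma> \<epsilon> by (intro mult_right_mono sobolev_weight_le triple_weight_nonneg) auto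
      also have "\<dots> = 2 powr \<sigma> * (bracket (freq t) powr (- 4 * \<epsilon>) * (1 / (bracket (a t) * bracket (b t) * bracket (d t))))"
        by (simp add: triple_weight_def a_def b_def d_def split_beta)
      also have "\<dots> \<le> 2 powr \<sigma> * (L powr (- \<epsilon>) * (h (a t) * h (b t) * h (d t) + h (freq t) * h (b t) * h (d t)
           + h (freq t) * h (a t) * h (d t) + h (freq t) * h (a t) * h (b t)))"
        unfolding h_def using large[of "a t" "b t" "d t"] that L \<epsilon> bracket_ge_1
        by (intro mult_left_mono product_weight_bound) (auto simp: fr a_def b_def d_def)
      finally show ?thesis .
    qed
    then have "(\<Sum>t\<in>B. (1 + (real_of_int (freq t))\<^sup>2) powr (- \<sigma>) * triple_weight t)
      \<le> (\<Sum>t\<in>B. 2 powr \<sigma> * (L powr (- \<epsilon>) * (h (a t) * h (b t) * h (d t) + h (freq t) * h (b t) * h (d t)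
           + h (freq t) * h (a t) * h (d t) + h (freq t) * h (a t) * h (b t))))" by (rule sum_mono)
    also have "\<dots> = 2 powr \<sigma> * (L powr (- \<epsilon>) * ((\<Sum>t\<in>B. h (a t) * h (b t) * h (d t)) + (\<Sum>t\<in>B. h (freq t) * h (b t) * h (d t))
           + (\<Sum>t\<in>B. h (freq t) * h (a t) * h (d t)) + (\<Sum>t\<in>B. h (freq t) * h (a t) * h (b t))))"
      by (simp only: sum_distrib_left[symmetric] sum.distrib)
    also have "\<dots> \<le> 2 powr \<sigma> * (L powr (- \<epsilon>) * (H ^ 3 + H ^ 3 + H ^ 3 + H ^ 3))"
    proof -
      have h0: "0 \<le> h n" for n by (simp add: h_def)
      have inj: "inj_on (\<lambda>t. (a t, b t, d t)) B" "inj_on (\<lambda>t. (freq t, b t, d t)) B"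
        "inj_on (\<lambda>t. (freq t, a t, d t)) B" "inj_on (\<lambda>t. (freq t, a t, b t)) B"
        by (auto simp: inj_on_def fr a_def b_def d_def)
      show ?thesis
        by (intro mult_left_mono add_mono sum_triple_product_le[OF h0 H(2) B] inj) auto
    qed
    finally show "(\<Sum>t\<in>B. (1 + (real_of_int (freq t))\<^sup>2) powr (- \<sigma>) * triple_weight t)
        \<le> 2 powr \<sigma> * (4 * H ^ 3) * L powr (- \<epsilon>)" by (simp add: mult_ac)
  qed
qed

section \<open>Fourier analysis on the circle\<close>

lemma expi_add: "expi a x * expi b x = expi (a + b) x"
  by (simp add: expi_def exp_add[symmetric] algebra_simps)

lemma expi_zero [simp]: "expi 0 x = 1"
  by (simp add: expi_def)

lemma cnj_expi: "cnj (expi a x) = expi (- a) x"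
  by (simp add: expi_def exp_cnj)

lemma expi_periodic: "expi n (x + 2 * pi) = expi n x"
proof -
  have "expi n (x + 2 * pi) = expi n x * exp (of_int n * (of_real pi * 2 * \<i>))"
    by (simp add: expi_def exp_add[symmetric] algebra_simps)
  also have "exp (of_int n * (of_real pi * 2 * \<i>)) = 1"
    using exp_integer_2pi[of "real_of_int n"] by (simp add: mult_ac)
  finally show ?thesis by simp
qed

lemma expi_has_vector_derivative:
  "(expi n has_vector_derivative \<i> * of_int n * expi n x) (at x within S)"
proof -
  have "((\<lambda>z. exp (\<i> * of_int n * z)) has_field_derivative \<i> * of_int n * exp (\<i> * of_int n * of_real x)) (at (of_real x))"
    by (auto intro!: derivative_eq_intros)
  from has_vector_derivative_real_field[OF this]
  show ?thesis unfolding expi_def[abs_def] by (rule has_vector_derivative_at_within)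
qed

lemma continuous_on_expi [continuous_intros]: "continuous_on S (expi n)"
  unfolding expi_def[abs_def] by (intro continuous_intros)

lemma nth_deriv_0 [simp]: "nth_deriv 0 f = f"
  by (simp add: nth_deriv_def)

lemma nth_deriv_Suc: "nth_deriv (Suc k) f = (\<lambda>x. vector_derivative (nth_deriv k f) (at x))"
  by (simp add: nth_deriv_def)

lemma nth_deriv_expi: "nth_deriv k (expi n) = (\<lambda>x. (\<i> * of_int n) ^ k * expi n x)"
proof (induction k)
  case (Suc k)
  have "((\<lambda>x. (\<i> * of_int n) ^ k * expi n x) has_vector_derivative (\<i> * of_int n) ^ k * (\<i> * of_int n * expi n x)) (at x)" for x
    by (intro has_vector_derivative_mult_right expi_has_vector_derivative)
  then show ?case unfolding nth_deriv_Suc Suc by (auto simp: vector_derivative_at mult_ac)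
qed simp

lemma expi_test_function: "expi n \<in> test_functions"
proof -
  have "(\<lambda>x. (\<i> * of_int n) ^ k * expi n x) differentiable (at x)" for k x
    by (rule differentiableI_vector[OF has_vector_derivative_mult_right[OF expi_has_vector_derivative]])
  then show ?thesis by (simp add: test_functions_def nth_deriv_expi expi_periodic)
qed

definition circle_mean :: "(real \<Rightarrow> complex) \<Rightarrow> complex" where
  "circle_mean f = of_real (1 / (2 * pi)) * (LBINT x:{0..2 * pi}. f x)"

lemma distr_of_fun_eq: "distr_of_fun f \<psi> = (if \<psi> \<in> test_functions then circle_mean (\<lambda>x. f x * \<psi> x) else 0)"
  by (simp add: distr_of_fun_def circle_mean_def)

lemma fourier_coeff_distr_of_fun: "fourier_coeff (distr_of_fun f) n = circle_mean (\<lambda>x. f x * expi (- n) x)"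
  by (simp add: fourier_coeff_def distr_of_fun_eq expi_test_function)

lemma circle_mean_expi: "circle_mean (expi n) = (if n = 0 then 1 else 0)"
proof (cases "n = 0")
  case True
  then show ?thesis by (simp add: circle_mean_def set_lebesgue_integral_def scaleR_conv_of_real)
next
  case False
  have "(LBINT x:{0..2 * pi}. expi n x) = expi n (2 * pi) / (\<i> * of_int n) - expi n 0 / (\<i> * of_int n)"
    unfolding set_lebesgue_integral_def
  proof (rule integral_FTC_Icc)
    show "((\<lambda>x. expi n x / (\<i> * of_int n)) has_vector_derivative expi n x) (at x within {0..2 * pi})" for x
      using has_vector_derivative_divide[OF expi_has_vector_derivative[of n x "{0..2 * pi}"], of "\<i> * of_int n"] False by simp
  qed (auto intro!: continuous_intros)
  then show ?thesis using False expi_periodic[of n 0] by (simp add: circle_mean_def)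
qed

lemma circle_mean_trig:
  assumes "finite B"
  shows "circle_mean (\<lambda>x. \<Sum>t\<in>B. \<alpha> t * expi (f t) x) = (\<Sum>t\<in>{t \<in> B. f t = 0}. \<alpha> t)"
proof -
  have int: "set_integrable lborel {0..2 * pi} (\<lambda>x. \<alpha> t * expi (f t) x)" for t
    by (intro borel_integrable_atLeastAtMost' continuous_intros)
  have "(LBINT x:{0..2 * pi}. \<Sum>t\<in>B. \<alpha> t * expi (f t) x) = (\<Sum>t\<in>B. LBINT x:{0..2 * pi}. \<alpha> t * expi (f t) x)"
    using int unfolding set_lebesgue_integral_def set_integrable_def scaleR_sum_right
    by (intro Bochner_Integration.integral_sum) auto
  then have "circle_mean (\<lambda>x. \<Sum>t\<in>B. \<alpha> t * expi (f t) x) = (\<Sum>t\<in>B. \<alpha> t * circle_mean (expi (f t)))"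
    by (simp add: circle_mean_def sum_distrib_left mult_ac)
  also have "\<dots> = (\<Sum>t\<in>{t \<in> B. f t = 0}. \<alpha> t)"
    using assms by (simp add: circle_mean_expi if_distrib sum.If_cases Int_def cong: if_cong)
  finally show ?thesis .
qed

lemma fourier_coeff_trig:
  assumes "finite B"
  shows "fourier_coeff (distr_of_fun (\<lambda>x. \<Sum>t\<in>B. \<alpha> t * expi (f t) x)) n = (\<Sum>t\<in>{t \<in> B. f t = n}. \<alpha> t)"
proof -
  have "(\<lambda>x. (\<Sum>t\<in>B. \<alpha> t * expi (f t) x) * expi (- n) x) = (\<lambda>x. \<Sum>t\<in>B. \<alpha> t * expi (f t - n) x)"
    by (simp add: sum_distrib_right mult.assoc expi_add)
  then show ?thesis
    unfolding fourier_coeff_distr_of_fun by (simp add: circle_mean_trig[OF assms])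
qed

lemma fourier_coeff_fourier_series: "fourier_coeff (fourier_series c) n = c n"
proof -
  have "distr_of_fun (expi m) (expi (- n)) = (if m = n then 1 else 0)" for m
    by (simp add: distr_of_fun_eq expi_test_function expi_add circle_mean_expi)
  then have "c m * distr_of_fun (expi m) (expi (- n)) = (if m = n then c m else 0)" for m
    by simp
  then have "fourier_coeff (fourier_series c) n = (\<Sum>\<^sub>\<infinity>m\<in>UNIV. if m = n then c m else 0)"
    by (simp only: fourier_coeff_def fourier_series_def expi_test_function if_True)
  also have "\<dots> = (\<Sum>\<^sub>\<infinity>m\<in>{n}. c m)" by (rule infsum_cong_neutral) auto
  finally show ?thesis by simp
qed

lemma fourier_coeff_diff: "fourier_coeff (u - v) n = fourier_coeff u n - fourier_coeff v n"
  by (simp add: fourier_coeff_def)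

lemma fourier_coeff_zero: "fourier_coeff (\<lambda>\<psi>. 0) n = 0"
  by (simp add: fourier_coeff_def)

lemma L2_circle_norm_trig:
  assumes A: "finite A"
  shows "(L2_circle_norm (\<lambda>x. \<Sum>n\<in>A. c n * expi n x))\<^sup>2 = (\<Sum>n\<in>A. (cmod (c n))\<^sup>2)"
proof -
  define v where "v = (\<lambda>x. \<Sum>n\<in>A. c n * expi n x)"
  define I where "I = (LBINT x:{0..2 * pi}. (cmod (v x))\<^sup>2)"
  have "complex_of_real ((cmod (v x))\<^sup>2) = (\<Sum>(m, n)\<in>A \<times> A. (c m * cnj (c n)) * expi (m - n) x)" for x
  proof -
    have "complex_of_real ((cmod (v x))\<^sup>2) = v x * cnj (v x)" by (simp only: complex_norm_square)
    also have "\<dots> = (\<Sum>m\<in>A. \<Sum>n\<in>A. (c m * expi m x) * (cnj (c n) * cnj (expi n x)))"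
      by (simp add: v_def sum_product)
    also have "\<dots> = (\<Sum>(m, n)\<in>A \<times> A. (c m * cnj (c n)) * (expi m x * expi (- n) x))"
      by (simp add: sum.cartesian_product cnj_expi mult_ac)
    finally show ?thesis by (simp add: expi_add)
  qed
  then have "circle_mean (\<lambda>x. complex_of_real ((cmod (v x))\<^sup>2)) =
      circle_mean (\<lambda>x. \<Sum>t\<in>A \<times> A. (c (fst t) * cnj (c (snd t))) * expi (fst t - snd t) x)"
    by (simp add: split_beta)
  also have "\<dots> = (\<Sum>t\<in>{t \<in> A \<times> A. fst t - snd t = 0}. c (fst t) * cnj (c (snd t)))"
    using A by (intro circle_mean_trig) auto
  also have "{t \<in> A \<times> A. fst t - snd t = 0} = (\<lambda>n. (n, n)) ` A" by auto
  also have "(\<Sum>t\<in>(\<lambda>n. (n, n)) ` A. c (fst t) * cnj (c (snd t))) = (\<Sum>n\<in>A. complex_of_real ((cmod (c n))\<^sup>2))"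
    by (subst sum.reindex) (auto simp: inj_on_def complex_norm_square[symmetric] simp del: of_real_power)
  finally have mean: "circle_mean (\<lambda>x. complex_of_real ((cmod (v x))\<^sup>2)) = of_real (\<Sum>n\<in>A. (cmod (c n))\<^sup>2)"
    by simp
  have "circle_mean (\<lambda>x. complex_of_real ((cmod (v x))\<^sup>2)) = of_real (1 / (2 * pi) * I)"
    unfolding circle_mean_def I_def by (simp only: set_integral_complex_of_real of_real_mult)
  then have "1 / (2 * pi) * I = (\<Sum>n\<in>A. (cmod (c n))\<^sup>2)"
    using mean by (metis of_real_eq_iff)
  then show ?thesis
    unfolding L2_circle_norm_def I_def v_def by (simp add: sum_nonneg)
qed

section \<open>Fourier coefficients of the renormalized nonlinearity\<close>

text \<open>
  The triples that contribute to the nonlinearity truncated at \<open>N\<close>; the output frequency is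
  truncated as well, because of the outer projection.
\<close>

definition box :: "nat \<Rightarrow> (int \<times> int \<times> int) set" where
  "box N = {t \<in> unpaired_triples \<inter> {- int N..int N} \<times> {- int N..int N} \<times> {- int N..int N}. freq t \<in> {- int N..int N}}"

lemma finite_box: "finite (box N)" and box_unpaired: "box N \<subseteq> unpaired_triples"
proof -
  have "box N \<subseteq> {- int N..int N} \<times> {- int N..int N} \<times> {- int N..int N}" by (auto simp: box_def)
  then show "finite (box N)" by (rule finite_subset) auto
qed (auto simp: box_def)

text \<open>
  In the convolution sum, the triples with \<open>a = b\<close> contribute \<open>(\<Sum> |c\<^sub>m|\<^sup>2) c\<^sub>n\<close>, and so do those with
  \<open>b = d\<close>; by inclusion and exclusion, subtracting twice this amount leaves the unpaired triples with
  the signs of \<open>cubic_term\<close>.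
\<close>

lemma wick_ordering_identity:
  assumes A: "finite A" and n: "n \<in> A"
  shows "(\<Sum>(a, b, d)\<in>{t \<in> A \<times> A \<times> A. freq t = n}. c a * cnj (c b) * c d) - 2 * (\<Sum>m\<in>A. of_real ((cmod (c m))\<^sup>2)) * c n
     = (\<Sum>t\<in>{t \<in> unpaired_triples \<inter> A \<times> A \<times> A. freq t = n}. cubic_term c t)"
proof -
  define mono where "mono = (\<lambda>(a, b, d). c a * cnj (c b) * c d)"
  define T where "T = {t \<in> A \<times> A \<times> A. freq t = n}"
  \<comment> \<open>The two pairings.\<close>
  define D1 where "D1 = {(a, b, d) \<in> T. a = b}"
  define D2 where "D2 = {(a, b, d) \<in> T. b = d}"
  define E where "E = (\<Sum>m\<in>A. complex_of_real ((cmod (c m))\<^sup>2))"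
  have sub: "D1 \<subseteq> T" "D2 \<subseteq> T" by (auto simp: D1_def D2_def)
  have "finite T" using A by (simp add: T_def)
  then have fin: "finite T" "finite D1" "finite D2" using sub by (auto intro: finite_subset)
  have "D1 = (\<lambda>m. (m, m, n)) ` A" using n by (auto simp: D1_def T_def freq_def image_iff)
  then have s1: "sum mono D1 = E * c n"
    by (simp add: sum.reindex inj_on_def mono_def E_def sum_distrib_right complex_norm_square del: of_real_power)
  have "D2 = (\<lambda>m. (n, m, m)) ` A" using n by (auto simp: D2_def T_def freq_def image_iff)
  then have s2: "sum mono D2 = E * c n"
    by (simp add: sum.reindex inj_on_def mono_def E_def sum_distrib_left complex_norm_square mult_ac del: of_real_power)
  have "sum mono T = sum mono (T - (D1 \<union> D2)) + sum mono (D1 \<union> D2)"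
    using fin sub by (intro sum.subset_diff) auto
  moreover have "sum mono (D1 \<union> D2) + sum mono (D1 \<inter> D2) = sum mono D1 + sum mono D2"
    using fin by (intro sum.union_inter)
  ultimately have "sum mono T - 2 * E * c n = sum mono (T - (D1 \<union> D2)) - sum mono (D1 \<inter> D2)"
    using s1 s2 by (simp add: algebra_simps)
  also have "\<dots> = sum (cubic_term c) (T - (D1 \<union> D2)) + sum (cubic_term c) (D1 \<inter> D2)"
  proof -
    have "sum mono (T - (D1 \<union> D2)) = sum (cubic_term c) (T - (D1 \<union> D2))"
      by (intro sum.cong refl) (auto simp: mono_def cubic_term_def D1_def split: if_splits)
    moreover have "- sum mono (D1 \<inter> D2) = sum (cubic_term c) (D1 \<inter> D2)"
      unfolding sum_negf[symmetric] by (intro sum.cong refl) (auto simp: mono_def cubic_term_def D1_def)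
    ultimately show ?thesis by simp
  qed
  also have "\<dots> = sum (cubic_term c) ((T - (D1 \<union> D2)) \<union> (D1 \<inter> D2))"
    using fin by (intro sum.union_disjoint[symmetric]) auto
  also have "(T - (D1 \<union> D2)) \<union> (D1 \<inter> D2) = {t \<in> unpaired_triples \<inter> A \<times> A \<times> A. freq t = n}"
    by (auto simp: T_def D1_def D2_def unpaired_triples_def)
  finally show ?thesis by (simp add: T_def mono_def E_def)
qed

lemma G_eq_trig:
  "G N u = distr_of_fun (\<lambda>x. \<Sum>n\<in>{- int N..int N}.
     (\<Sum>t\<in>{t \<in> box N. freq t = n}. cubic_term (fourier_coeff u) t) * expi n x)"
proof -
  define A where "A = {- int N..int N}"
  define c where "c = fourier_coeff u"
  define v where "v = (\<lambda>x. \<Sum>n\<in>A. c n * expi n x)"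
  define E where "E = (\<Sum>m\<in>A. complex_of_real ((cmod (c m))\<^sup>2))"
  have A: "finite A" by (simp add: A_def)
  have proj: "fourier_proj N u = v" by (simp add: fourier_proj_def v_def A_def c_def)
  have E: "complex_of_real ((L2_circle_norm v)\<^sup>2) = E"
    unfolding v_def L2_circle_norm_trig[OF A] E_def by simp
  have cub: "of_real ((cmod (v x))\<^sup>2) * v x = (\<Sum>t\<in>A \<times> A \<times> A. (\<lambda>(a, b, d). c a * cnj (c b) * c d) t * expi (freq t) x)" for x
  proof -
    have "of_real ((cmod (v x))\<^sup>2) * v x = v x * (cnj (v x) * v x)" by (simp only: complex_norm_square mult.assoc)
    also have "\<dots> = (\<Sum>a\<in>A. \<Sum>b\<in>A. \<Sum>d\<in>A. (c a * expi a x) * ((cnj (c b) * expi (- b) x) * (c d * expi d x)))"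
      by (simp add: v_def sum_product cnj_expi) (simp add: sum_distrib_left)
    also have "\<dots> = (\<Sum>(a, b, d)\<in>A \<times> A \<times> A. (c a * cnj (c b) * c d) * (expi a x * expi (- b) x * expi d x))"
      by (simp add: sum.cartesian_product mult_ac)
    finally show ?thesis by (simp add: expi_add freq_def split_beta)
  qed
  have coeff: "fourier_coeff (distr_of_fun (\<lambda>y. of_real ((cmod (v y))\<^sup>2) * v y)) n
      = (\<Sum>(a, b, d)\<in>{t \<in> A \<times> A \<times> A. freq t = n}. c a * cnj (c b) * c d)" for n
    unfolding cub using A by (subst fourier_coeff_trig) (auto simp: split_beta)
  have "G N u = distr_of_fun (\<lambda>x. \<Sum>n\<in>A. ((\<Sum>(a, b, d)\<in>{t \<in> A \<times> A \<times> A. freq t = n}. c a * cnj (c b) * c d) - 2 * E * c n) * expi n x)"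
  proof -
    have "fourier_proj N (distr_of_fun (\<lambda>y. of_real ((cmod (v y))\<^sup>2) * v y)) x - 2 * E * v x
      = (\<Sum>n\<in>A. ((\<Sum>(a, b, d)\<in>{t \<in> A \<times> A \<times> A. freq t = n}. c a * cnj (c b) * c d) - 2 * E * c n) * expi n x)" for x
      by (simp only: fourier_proj_def coeff A_def[symmetric])
        (simp add: v_def sum_distrib_left left_diff_distrib sum_subtractf mult.assoc)
    then show ?thesis unfolding G_def Let_def proj E by simp
  qed
  also have "\<dots> = distr_of_fun (\<lambda>x. \<Sum>n\<in>A. (\<Sum>t\<in>{t \<in> box N. freq t = n}. cubic_term c t) * expi n x)"
  proof (intro arg_cong[where f = distr_of_fun] ext sum.cong refl)
    fix x n assume n: "n \<in> A"
    have "{t \<in> box N. freq t = n} = {t \<in> unpaired_triples \<inter> A \<times> A \<times> A. freq t = n}"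
      using n by (auto simp: box_def A_def)
    then show "((\<Sum>(a, b, d)\<in>{t \<in> A \<times> A \<times> A. freq t = n}. c a * cnj (c b) * c d) - 2 * E * c n) * expi n x
        = (\<Sum>t\<in>{t \<in> box N. freq t = n}. cubic_term c t) * expi n x"
      unfolding E_def wick_ordering_identity[OF A n] by simp
  qed
  finally show ?thesis by (simp add: A_def c_def)
qed

lemma fourier_coeff_G:
  "fourier_coeff (G N u) n = (\<Sum>t\<in>{t \<in> box N. freq t = n}. cubic_term (fourier_coeff u) t)"
proof (cases "n \<in> {- int N..int N}")
  case True
  then have "{t \<in> {- int N..int N}. t = n} = {n}" by auto
  then show ?thesis unfolding G_eq_trig by (subst fourier_coeff_trig) auto
next
  case False
  then have e: "{t \<in> {- int N..int N}. t = n} = {}" "{t \<in> box N. freq t = n} = {}" by (auto simp: box_def)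
  show ?thesis unfolding G_eq_trig by (subst fourier_coeff_trig) (simp_all only: e finite_atLeastAtMost_int sum.empty)
qed

section \<open>Sobolev norms of the nonlinearity\<close>

lemma test_function_continuous: "\<psi> \<in> test_functions \<Longrightarrow> continuous_on S \<psi>"
  unfolding test_functions_def
  by (auto intro!: continuous_at_imp_continuous_on differentiable_imp_continuous_within dest: spec[of _ 0])

lemma nth_deriv_linear:
  assumes "\<psi> \<in> test_functions" "\<phi> \<in> test_functions"
  shows "nth_deriv k (\<lambda>x. a * \<psi> x + b * \<phi> x) = (\<lambda>x. a * nth_deriv k \<psi> x + b * nth_deriv k \<phi> x)"
proof (induction k)
  case (Suc k)
  have "(nth_deriv k f has_vector_derivative nth_deriv (Suc k) f x) (at x)" if "f \<in> test_functions" for f x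
    using that unfolding nth_deriv_Suc test_functions_def by (auto simp: vector_derivative_works[symmetric])
  then have "((\<lambda>x. a * nth_deriv k \<psi> x + b * nth_deriv k \<phi> x) has_vector_derivative
      a * nth_deriv (Suc k) \<psi> x + b * nth_deriv (Suc k) \<phi> x) (at x)" for x
    using assms by (intro has_vector_derivative_add has_vector_derivative_mult_right) auto
  then show ?case
    by (subst nth_deriv_Suc) (auto simp: Suc.IH vector_derivative_at)
qed simp

lemma test_functions_linear:
  assumes "\<psi> \<in> test_functions" "\<phi> \<in> test_functions"
  shows "(\<lambda>x. a * \<psi> x + b * \<phi> x) \<in> test_functions"
  using assms nth_deriv_linear[OF assms, of _ a b] unfolding test_functions_def by auto

lemma distr_of_fun_distribution:
  assumes f: "continuous_on {0..2 * pi} f"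
  shows "distr_of_fun f \<in> distributions"
proof -
  have int: "set_integrable lborel {0..2 * pi} (\<lambda>x. f x * \<psi> x)" if "\<psi> \<in> test_functions" for \<psi>
    by (intro borel_integrable_atLeastAtMost' continuous_on_mult f test_function_continuous that)
  have lin: "distr_of_fun f (\<lambda>x. a * \<psi> x + b * \<phi> x) = a * distr_of_fun f \<psi> + b * distr_of_fun f \<phi>"
    if t: "\<psi> \<in> test_functions" "\<phi> \<in> test_functions" for \<psi> \<phi> a b
  proof -
    have "(LBINT x:{0..2 * pi}. f x * (a * \<psi> x + b * \<phi> x)) =
        (LBINT x:{0..2 * pi}. a * (f x * \<psi> x) + b * (f x * \<phi> x))" by (simp add: algebra_simps)
    also have "\<dots> = a * (LBINT x:{0..2 * pi}. f x * \<psi> x) + b * (LBINT x:{0..2 * pi}. f x * \<phi> x)"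
      using int[OF t(1)] int[OF t(2)] by (subst set_integral_add) auto
    finally show ?thesis using t test_functions_linear[OF t, of a b] by (simp add: distr_of_fun_def algebra_simps)
  qed
  obtain b where b: "\<And>x. x \<in> {0..2 * pi} \<Longrightarrow> cmod (f x) \<le> b"
    using compact_imp_bounded[OF compact_continuous_image[OF f]] unfolding bounded_iff by fastforce
  have "cmod (distr_of_fun f \<psi>) \<le> b * (\<Sum>j\<le>0. SUP x\<in>{0..2 * pi}. cmod (nth_deriv j \<psi> x))"
    if t: "\<psi> \<in> test_functions" for \<psi>
  proof -
    define S where "S = (SUP x\<in>{0..2 * pi}. cmod (\<psi> x))"
    have "bdd_above ((\<lambda>x. cmod (\<psi> x)) ` {0..2 * pi})"
      by (intro bounded_imp_bdd_above compact_imp_bounded compact_continuous_image continuous_on_norm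
          test_function_continuous t compact_Icc)
    then have S: "cmod (\<psi> x) \<le> S" if "x \<in> {0..2 * pi}" for x
      unfolding S_def using that by (intro cSUP_upper)
    have b0: "0 \<le> b" using order_trans[OF norm_ge_zero b[of 0]] by simp
    have "cmod (LBINT x:{0..2 * pi}. f x * \<psi> x) \<le> (LBINT x:{0..2 * pi}. cmod (f x * \<psi> x))"
      by (rule set_integral_norm_bound[OF int[OF t]])
    also have "\<dots> \<le> (LBINT x:{0..2 * pi}. b * S)"
      using b S b0
      by (intro set_integral_mono borel_integrable_atLeastAtMost' continuous_on_norm continuous_on_mult f
          continuous_on_const test_function_continuous t)
        (auto simp: norm_mult intro!: mult_mono)
    also have "\<dots> = 2 * pi * (b * S)" by (simp add: set_lebesgue_integral_def)
    finally have "cmod (distr_of_fun f \<psi>) \<le> 1 / (2 * pi) * (2 * pi * (b * S))"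
      using t unfolding distr_of_fun_def by (simp add: norm_mult norm_divide divide_le_eq mult_ac)
    then show ?thesis by (simp add: S_def)
  qed
  then have "\<exists>C k. \<forall>\<psi>\<in>test_functions.
      cmod (distr_of_fun f \<psi>) \<le> C * (\<Sum>j\<le>k. SUP x\<in>{0..2 * pi}. cmod (nth_deriv j \<psi> x))"
    by blast
  then show ?thesis
    unfolding distributions_def using lin by (intro CollectI conjI allI ballI impI) (simp_all add: distr_of_fun_eq)
qed

lemma summable_on_finite_support:
  fixes f :: "int \<Rightarrow> real"
  assumes "finite S" "\<And>n. n \<notin> S \<Longrightarrow> f n = 0"
  shows "f summable_on UNIV" "(\<Sum>\<^sub>\<infinity>n. f n) = sum f S"
proof -
  show "f summable_on UNIV"
    using summable_on_cong_neutral[of UNIV S f f] assms by auto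
  have "(\<Sum>\<^sub>\<infinity>n. f n) = infsum f S" using assms by (intro infsum_cong_neutral) auto
  then show "(\<Sum>\<^sub>\<infinity>n. f n) = sum f S" using assms by simp
qed

lemma G_in_sobolev: "G N u \<in> sobolev s"
proof -
  have "G N u \<in> distributions"
    unfolding G_eq_trig by (intro distr_of_fun_distribution continuous_intros)
  moreover have "(\<lambda>n. (1 + (real_of_int n)\<^sup>2) powr s * (cmod (fourier_coeff (G N u) n))\<^sup>2) summable_on UNIV"
  proof (rule summable_on_finite_support[of "freq ` box N"])
    fix n assume "n \<notin> freq ` box N"
    then have "{t \<in> box N. freq t = n} = {}" by auto
    then show "(1 + (real_of_int n)\<^sup>2) powr s * (cmod (fourier_coeff (G N u) n))\<^sup>2 = 0"
      unfolding fourier_coeff_G by (simp only: sum.empty) simp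
  qed (simp add: finite_box)
  ultimately show ?thesis by (simp add: sobolev_def)
qed

lemma sobolev_norm_finite:
  assumes "finite S" "\<And>n. n \<notin> S \<Longrightarrow> fourier_coeff u n = 0"
  shows "sobolev_norm s u = sqrt (\<Sum>n\<in>S. (1 + (real_of_int n)\<^sup>2) powr s * (cmod (fourier_coeff u n))\<^sup>2)"
  unfolding sobolev_norm_def by (subst summable_on_finite_support[OF assms(1)]) (simp_all add: assms(2))

text \<open>
  The Sobolev norm of \<open>G N u - G M u\<close> as an explicit function of the Fourier coefficients of \<open>u\<close>,
  for \<open>B\<close> the set of triples that enter at truncation \<open>N\<close> but not at \<open>M\<close>.
\<close>

definition cubic_norm :: "real \<Rightarrow> (int \<times> int \<times> int) set \<Rightarrow> (int \<Rightarrow> complex) \<Rightarrow> real" where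
  "cubic_norm s B c = sqrt (\<Sum>n\<in>freq ` B. (1 + (real_of_int n)\<^sup>2) powr s *
     (cmod (\<Sum>t\<in>{t \<in> B. freq t = n}. cubic_term c t))\<^sup>2)"

lemma sobolev_norm_cubic:
  assumes "finite B" "\<And>n. fourier_coeff u n = (\<Sum>t\<in>{t \<in> B. freq t = n}. cubic_term c t)"
  shows "sobolev_norm s u = cubic_norm s B c"
proof -
  have "fourier_coeff u n = 0" if "n \<notin> freq ` B" for n
  proof -
    have "{t \<in> B. freq t = n} = {}" using that by auto
    then show ?thesis unfolding assms(2) by (simp only: sum.empty)
  qed
  then show ?thesis
    using assms unfolding cubic_norm_def by (subst sobolev_norm_finite[of "freq ` B"]) auto
qed

lemma sobolev_norm_G: "sobolev_norm s (G N u) = cubic_norm s (box N) (fourier_coeff u)"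
  by (intro sobolev_norm_cubic finite_box fourier_coeff_G)

lemma sobolev_norm_G_diff:
  assumes "M \<le> N"
  shows "sobolev_norm s (G N u - G M u) = cubic_norm s (box N - box M) (fourier_coeff u)"
proof (intro sobolev_norm_cubic)
  fix n
  have "{- int M..int M} \<subseteq> {- int N..int N}" using assms by auto
  then have "box M \<subseteq> box N" by (auto simp: box_def)
  then have "{t \<in> box M. freq t = n} \<subseteq> {t \<in> box N. freq t = n}" by auto
  moreover have "{t \<in> box N - box M. freq t = n} = {t \<in> box N. freq t = n} - {t \<in> box M. freq t = n}" by auto
  ultimately show "fourier_coeff (G N u - G M u) n = (\<Sum>t\<in>{t \<in> box N - box M. freq t = n}. cubic_term (fourier_coeff u) t)"
    unfolding fourier_coeff_diff fourier_coeff_G using finite_box by (simp add: sum_diff)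
qed (simp add: finite_box)

lemma sobolev_norm_diff_commute: "sobolev_norm s (u - v) = sobolev_norm s (v - u)"
  by (simp add: sobolev_norm_def fourier_coeff_diff norm_minus_commute)

lemma sobolev_norm_zero [simp]: "sobolev_norm s (u - u) = 0"
  by (simp add: sobolev_norm_def fourier_coeff_diff)

lemma continuous_on_cubic_term: "continuous_on UNIV (\<lambda>c. cubic_term c t)"
  unfolding cubic_term_def split_beta
  by (intro continuous_on_mult continuous_on_cnj continuous_on_const continuous_on_product_coordinates)

lemma continuous_on_cubic_norm: "continuous_on UNIV (cubic_norm s B)"
  unfolding cubic_norm_def[abs_def]
  by (intro continuous_on_real_sqrt continuous_on_sum continuous_on_mult continuous_on_power
      continuous_on_norm continuous_on_const continuous_on_cubic_term)

lemma summable_on_norm_diff_squared: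
  fixes f g :: "int \<Rightarrow> complex"
  assumes w: "\<And>n. 0 \<le> w n" and "(\<lambda>n. w n * (cmod (f n))\<^sup>2) summable_on UNIV" "(\<lambda>n. w n * (cmod (g n))\<^sup>2) summable_on UNIV"
  shows "(\<lambda>n. w n * (cmod (f n - g n))\<^sup>2) summable_on UNIV"
proof (rule summable_on_comparison_test)
  show "(\<lambda>n. 2 * (w n * (cmod (f n))\<^sup>2) + 2 * (w n * (cmod (g n))\<^sup>2)) summable_on UNIV"
    using assms by (intro summable_on_add summable_on_cmult_right)
  fix n
  have "(cmod (f n - g n))\<^sup>2 \<le> (cmod (f n) + cmod (g n))\<^sup>2"
    by (intro power_mono norm_triangle_ineq4) auto
  also have "\<dots> \<le> 2 * (cmod (f n))\<^sup>2 + 2 * (cmod (g n))\<^sup>2"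
    using sum_squares_bound[of "cmod (f n)" "cmod (g n)"] by (simp add: power2_sum)
  finally have "w n * (cmod (f n - g n))\<^sup>2 \<le> w n * (2 * (cmod (f n))\<^sup>2 + 2 * (cmod (g n))\<^sup>2)"
    using w by (intro mult_left_mono)
  then show "w n * (cmod (f n - g n))\<^sup>2 \<le> 2 * (w n * (cmod (f n))\<^sup>2) + 2 * (w n * (cmod (g n))\<^sup>2)"
    by (simp add: algebra_simps)
qed (use w in auto)

lemma fourier_coeff_le_sobolev_norm:
  assumes "u \<in> sobolev s" "v \<in> sobolev s"
  shows "(1 + (real_of_int n)\<^sup>2) powr (s / 2) * cmod (fourier_coeff u n - fourier_coeff v n) \<le> sobolev_norm s (u - v)"
proof -
  have "(\<lambda>n. (1 + (real_of_int n)\<^sup>2) powr s * (cmod (fourier_coeff u n - fourier_coeff v n))\<^sup>2) summable_on UNIV"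
    using assms by (intro summable_on_norm_diff_squared) (auto simp: sobolev_def)
  from finite_sum_le_infsum[OF this, of "{n}"]
  have "(1 + (real_of_int n)\<^sup>2) powr s * (cmod (fourier_coeff u n - fourier_coeff v n))\<^sup>2 \<le> (sobolev_norm s (u - v))\<^sup>2"
    unfolding sobolev_norm_def fourier_coeff_diff by (simp add: infsum_nonneg)
  moreover have "(1 + (real_of_int n)\<^sup>2) powr s = ((1 + (real_of_int n)\<^sup>2) powr (s / 2))\<^sup>2"
    by (simp add: power2_eq_square powr_add[symmetric])
  ultimately have "((1 + (real_of_int n)\<^sup>2) powr (s / 2) * cmod (fourier_coeff u n - fourier_coeff v n))\<^sup>2 \<le> (sobolev_norm s (u - v))\<^sup>2"
    by (simp add: power_mult_distrib)
  then show ?thesis by (rule power2_le_imp_le) (simp add: sobolev_norm_def infsum_nonneg)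
qed

section \<open>Continuity in the Fourier coefficients\<close>

lemma topspace_sobolev_topology [simp]: "topspace (sobolev_topology s) = sobolev s"
proof -
  have "sobolev s \<subseteq> \<Union>{{v \<in> sobolev s. sobolev_norm s (v - u) < r} |u r. u \<in> sobolev s \<and> 0 < r}"
  proof
    fix u assume u: "u \<in> sobolev s"
    show "u \<in> \<Union>{{v \<in> sobolev s. sobolev_norm s (v - u) < r} |u r. u \<in> sobolev s \<and> 0 < r}"
    proof (rule UnionI)
      show "{v \<in> sobolev s. sobolev_norm s (v - u) < 1} \<in>
          {{v \<in> sobolev s. sobolev_norm s (v - u) < r} |u r. u \<in> sobolev s \<and> 0 < r}"
        using u by (intro CollectI exI[of _ u] exI[of _ "1::real"]) simp
    qed (use u in simp)
  qed
  then show ?thesis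
    unfolding sobolev_topology_def topology_generated_by_topspace by auto
qed

lemma topspace_X0_topology [simp]: "topspace X0_topology = X0"
proof -
  have "openin (sobolev_topology (- 1)) (sobolev (- 1))" using openin_topspace[of "sobolev_topology (- 1)"] by simp
  moreover have "X0 \<subseteq> sobolev (- 1)" by (auto simp: X0_def)
  ultimately have "X0 \<in> {X0 \<inter> U |U \<sigma>. 0 < \<sigma> \<and> openin (sobolev_topology (- \<sigma>)) U}"
    by (intro CollectI exI[of _ "sobolev (- 1)"] exI[of _ 1]) auto
  then show ?thesis unfolding X0_topology_def topology_generated_by_topspace by auto
qed

text \<open>
  A single Fourier coefficient is bounded by any Sobolev norm, here that of \<open>H\<^sup>-\<^sup>1\<close>.
\<close>

lemma continuous_map_fourier_coeff: "continuous_map X0_topology euclidean (\<lambda>u. fourier_coeff u n)"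
  unfolding continuous_map_def
proof (intro conjI allI impI)
  fix V :: "complex set" assume "openin euclidean V"
  then have V: "open V" by simp
  show "openin X0_topology {u \<in> topspace X0_topology. fourier_coeff u n \<in> V}"
  proof (subst openin_subopen, intro ballI)
    fix u assume "u \<in> {u \<in> topspace X0_topology. fourier_coeff u n \<in> V}"
    then have u: "u \<in> X0" "fourier_coeff u n \<in> V" by auto
    from V u(2) obtain e where e: "e > 0" "ball (fourier_coeff u n) e \<subseteq> V"
      using open_contains_ball by blast
    define w where "w = (1 + (real_of_int n)\<^sup>2) powr (- 1 / 2)"
    have w: "w > 0" by (simp add: w_def add_pos_nonneg less_imp_neq[THEN not_sym])
    have X0: "X0 \<subseteq> sobolev (- 1)" by (auto simp: X0_def)
    define U where "U = {v \<in> sobolev (- 1). sobolev_norm (- 1) (v - u) < w * e}"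
    have "openin (sobolev_topology (- 1)) U"
      unfolding sobolev_topology_def U_def using u X0 w e
      by (intro topology_generated_by_Basis CollectI exI[of _ u] exI[of _ "w * e"]) auto
    then have "openin X0_topology (X0 \<inter> U)"
      unfolding X0_topology_def by (intro topology_generated_by_Basis CollectI exI[of _ U] exI[of _ 1]) auto
    moreover have "u \<in> X0 \<inter> U" using u X0 w e by (auto simp: U_def)
    moreover have "X0 \<inter> U \<subseteq> {u \<in> topspace X0_topology. fourier_coeff u n \<in> V}"
    proof
      fix v assume v: "v \<in> X0 \<inter> U"
      have "w * cmod (fourier_coeff v n - fourier_coeff u n) \<le> sobolev_norm (- 1) (v - u)"
        unfolding w_def using fourier_coeff_le_sobolev_norm[of v "- 1" u n] v u X0 by (auto simp: U_def)
      also have "\<dots> < w * e" using v by (simp add: U_def)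
      finally have "fourier_coeff v n \<in> ball (fourier_coeff u n) e"
        using w by (simp add: dist_norm norm_minus_commute)
      then show "v \<in> {u \<in> topspace X0_topology. fourier_coeff u n \<in> V}" using v e by auto
    qed
    ultimately show "\<exists>T. openin X0_topology T \<and> u \<in> T \<and> T \<subseteq> {u \<in> topspace X0_topology. fourier_coeff u n \<in> V}"
      by blast
  qed
qed simp

text \<open>
  The space of coefficient sequences carries the product topology, so that every continuous expression
  in finitely many coefficients is covered.
\<close>

lemma continuous_map_coeff_function:
  fixes F :: "(int \<Rightarrow> complex) \<Rightarrow> 'b :: topological_space"
  assumes "continuous_on UNIV F"
  shows "continuous_map X0_topology euclidean (\<lambda>u. F (fourier_coeff u))"
proof -
  have "continuous_map X0_topology (product_topology (\<lambda>_. euclidean) UNIV) fourier_coeff"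
    unfolding continuous_map_componentwise_UNIV using continuous_map_fourier_coeff by blast
  then have "continuous_map X0_topology euclidean fourier_coeff"
    by (simp only: euclidean_product_topology)
  moreover have "continuous_map euclidean euclidean F" using assms by simp
  ultimately show ?thesis using continuous_map_compose[of X0_topology euclidean fourier_coeff euclidean F]
    by (simp add: comp_def)
qed

lemma space_borel_of_topology [simp]: "space (borel_of_topology T) = topspace T"
  unfolding borel_of_topology_def by (rule space_measure_of) (auto dest: openin_subset)

lemma sets_borel_of_topology: "sets (borel_of_topology T) = sigma_sets (topspace T) {U. openin T U}"
  unfolding borel_of_topology_def by (rule sets_measure_of) (auto dest: openin_subset)

lemma continuous_map_measurable:
  assumes "continuous_map T1 T2 f"
  shows "f \<in> borel_of_topology T1 \<rightarrow>\<^sub>M borel_of_topology T2"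
proof (rule measurable_sigma_sets[OF sets_borel_of_topology])
  show "f \<in> space (borel_of_topology T1) \<rightarrow> topspace T2"
    using continuous_map_image_subset_topspace[OF assms] by auto
  show "f -` U \<inter> space (borel_of_topology T1) \<in> sets (borel_of_topology T1)" if "U \<in> {U. openin T2 U}" for U
    using continuous_map_open[OF assms] that unfolding sets_borel_of_topology by (auto intro!: sigma_sets.Basic)
qed (auto dest: openin_subset)

lemma borel_of_topology_euclidean: "sets (borel_of_topology euclidean) = sets borel"
  by (simp add: sets_borel_of_topology borel_def)

lemma borel_measurable_coeff_function:
  assumes "continuous_on UNIV F"
  shows "(\<lambda>u. F (fourier_coeff u)) \<in> borel_measurable (borel_of_topology X0_topology)"
  using continuous_map_measurable[OF continuous_map_coeff_function[OF assms]]
  by (simp add: measurable_cong_sets[OF refl borel_of_topology_euclidean])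

text \<open>
  Only finitely many coefficients of \<open>G N u\<close> are nonzero, so its distance to a fixed \<open>z\<close> is a continuous
  function of finitely many coefficients of \<open>u\<close>, up to the constant contribution of the tail of \<open>z\<close>.
\<close>

lemma continuous_map_G: "continuous_map X0_topology (sobolev_topology s) (G N)"
  unfolding sobolev_topology_def
proof (rule continuous_on_generated_topo)
  show "G N ` topspace X0_topology \<subseteq> \<Union>{{v \<in> sobolev s. sobolev_norm s (v - u) < r} |u r. u \<in> sobolev s \<and> 0 < r}"
    unfolding topspace_sobolev_topology[of s, unfolded sobolev_topology_def topology_generated_by_topspace]
    by (intro image_subsetI G_in_sobolev)
next
  fix U assume "U \<in> {{v \<in> sobolev s. sobolev_norm s (v - u) < r} |u r. u \<in> sobolev s \<and> 0 < r}"
  then obtain z r where z: "z \<in> sobolev s" and U: "U = {v \<in> sobolev s. sobolev_norm s (v - z) < r}" by blast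
  define w where "w = (\<lambda>n::int. (1 + (real_of_int n)\<^sup>2) powr s)"
  define S where "S = freq ` box N"
  define p where "p = (\<lambda>c n. \<Sum>t\<in>{t \<in> box N. freq t = n}. cubic_term c t)"
  define F where "F = (\<lambda>c. sqrt ((\<Sum>n\<in>S. w n * (cmod (p c n - fourier_coeff z n))\<^sup>2)
      + (\<Sum>\<^sub>\<infinity>n\<in>- S. w n * (cmod (fourier_coeff z n))\<^sup>2)))"
  have S: "finite S" by (simp add: S_def finite_box)
  have p0: "p c n = 0" if "n \<in> - S" for c n
  proof -
    have "{t \<in> box N. freq t = n} = {}" using that by (auto simp: S_def)
    then show ?thesis unfolding p_def by (simp only: sum.empty)
  qed
  have norm_eq: "sobolev_norm s (G N u - z) = F (fourier_coeff u)" for u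
  proof -
    have sm: "(\<lambda>n. w n * (cmod (fourier_coeff z n))\<^sup>2) summable_on - S"
      by (rule summable_on_subset_banach[where A = UNIV]) (use z in \<open>simp_all add: sobolev_def w_def\<close>)
    have tail: "(\<lambda>n. w n * (cmod (p (fourier_coeff u) n - fourier_coeff z n))\<^sup>2) summable_on - S
       \<longleftrightarrow> (\<lambda>n. w n * (cmod (fourier_coeff z n))\<^sup>2) summable_on - S"
      by (intro summable_on_cong) (simp add: p0)
    have "(\<Sum>\<^sub>\<infinity>n\<in>S \<union> - S. w n * (cmod (p (fourier_coeff u) n - fourier_coeff z n))\<^sup>2) =
       (\<Sum>\<^sub>\<infinity>n\<in>S. w n * (cmod (p (fourier_coeff u) n - fourier_coeff z n))\<^sup>2)
      + (\<Sum>\<^sub>\<infinity>n\<in>- S. w n * (cmod (p (fourier_coeff u) n - fourier_coeff z n))\<^sup>2)"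
      by (intro infsum_Un_disjoint tail[THEN iffD2, OF sm] summable_on_finite S) simp
    also have "(\<Sum>\<^sub>\<infinity>n\<in>- S. w n * (cmod (p (fourier_coeff u) n - fourier_coeff z n))\<^sup>2)
       = (\<Sum>\<^sub>\<infinity>n\<in>- S. w n * (cmod (fourier_coeff z n))\<^sup>2)"
      by (intro infsum_cong) (simp add: p0)
    finally show ?thesis
      using S by (simp add: sobolev_norm_def F_def fourier_coeff_diff fourier_coeff_G p_def w_def)
  qed
  have "continuous_on UNIV F" unfolding F_def p_def
    by (intro continuous_on_real_sqrt continuous_on_add continuous_on_sum continuous_on_mult continuous_on_power
      continuous_on_norm continuous_on_diff continuous_on_const continuous_on_cubic_term)
  then have "continuous_map X0_topology euclidean (\<lambda>u. F (fourier_coeff u))"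
    by (rule continuous_map_coeff_function)
  then have "openin X0_topology ((\<lambda>u. F (fourier_coeff u)) -` {..<r} \<inter> topspace X0_topology)"
    by (rule continuous_map_open) (simp only: open_openin[symmetric] open_lessThan)
  moreover have "(\<lambda>u. F (fourier_coeff u)) -` {..<r} = G N -` U"
    unfolding U norm_eq[symmetric] by (simp only: vimage_def mem_Collect_eq lessThan_iff G_in_sobolev simp_thms)
  ultimately show "openin X0_topology (G N -` U \<inter> topspace X0_topology)" by simp
qed

section \<open>Moments under the Gaussian law\<close>

text \<open>
  If \<open>T\<close> is not measurable, then some set and its complement both have a nonmeasurable preimage and
  hence image measure zero, so that the image measure vanishes altogether. This half of the change of
  variables formula bounds integrals against the law of the random series.
\<close>

lemma nn_integral_distr_le:
  assumes T: "T \<in> space M \<rightarrow> space N" and f: "f \<in> borel_measurable N"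
  shows "(\<integral>\<^sup>+y. f y \<partial>distr M N T) \<le> (\<integral>\<^sup>+x. f (T x) \<partial>M)"
proof (cases "T \<in> M \<rightarrow>\<^sub>M N")
  case True
  then show ?thesis using f by (simp add: nn_integral_distr)
next
  case False
  then obtain A where A: "A \<in> sets N" "T -` A \<inter> space M \<notin> sets M"
    using T by (auto simp: measurable_def)
  have "T -` (space N - A) \<inter> space M = space M - (T -` A \<inter> space M)" using T by auto
  then have A': "T -` (space N - A) \<inter> space M \<notin> sets M"
    using A(2) sets.compl_sets[of "T -` (space N - A) \<inter> space M" M] by (auto simp: Diff_Diff_Int Int_absorb1)
  have zero: "emeasure (distr M N T) B = 0" if "T -` B \<inter> space M \<notin> sets M" for B
    using that unfolding distr_def emeasure_measure_of_conv by (simp add: emeasure_notin_sets)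
  have "emeasure (distr M N T) (space N) = emeasure (distr M N T) A + emeasure (distr M N T) (space N - A)"
    using A(1) sets.sets_into_space[OF A(1)] by (subst plus_emeasure) (auto simp: Un_absorb1)
  then have "emeasure (distr M N T) (space N) = 0" using zero A(2) A' by simp
  then have "space N \<in> null_sets (distr M N T)" by (auto simp: null_sets_def)
  then have "AE y in distr M N T. f y = 0"
    by (rule AE_I') auto
  then have "(\<integral>\<^sup>+y. f y \<partial>distr M N T) = (\<integral>\<^sup>+y. 0 \<partial>distr M N T)" by (intro nn_integral_cong_AE)
  then show ?thesis by simp
qed

text \<open>
  The Fourier coefficients of the random series are either the expected ones, or all zero at points where the
  series leaves \<open>X0\<close>. As the cubic norm vanishes at zero, upper bounds may always use the former.
\<close>

lemma fourier_coeff_random_series: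
  "fourier_coeff (random_series g \<omega>) = (\<lambda>n. g n \<omega> / of_real (bracket n powr (1 / 2)))
   \<or> fourier_coeff (random_series g \<omega>) = (\<lambda>n. 0)"
proof -
  define u where "u = fourier_series (\<lambda>n. g n \<omega> / of_real ((1 + \<bar>real_of_int n\<bar>) powr (1 / 2)))"
  have "fourier_coeff u = (\<lambda>n. g n \<omega> / of_real (bracket n powr (1 / 2)))"
    unfolding u_def fourier_coeff_fourier_series[abs_def] bracket_def ..
  moreover have "random_series g \<omega> = u \<or> random_series g \<omega> = (\<lambda>\<psi>. 0)"
    unfolding random_series_def Let_def u_def by (simp split: if_splits)
  ultimately show ?thesis using fourier_coeff_zero by auto
qed

lemma zero_in_X0: "(\<lambda>\<psi>. 0) \<in> X0"
proof -
  have "(\<lambda>\<psi>. 0) \<in> distributions"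
    unfolding distributions_def by (auto intro!: exI[of _ 0])
  then show ?thesis by (simp add: X0_def sobolev_def fourier_coeff_zero)
qed

lemma random_series_in_X0: "random_series g \<omega> \<in> X0"
  unfolding random_series_def Let_def by (auto intro: zero_in_X0)

lemma cubic_norm_zero: "cubic_norm s B (\<lambda>n. 0) = 0"
  by (simp add: cubic_norm_def cubic_term_def split_beta)

text \<open>
  Passes from an even moment \<open>q\<close> to a smaller exponent \<open>p\<close> by splitting at the level \<open>l\<close>; choosing \<open>l\<close>
  as the expected size of \<open>x\<close> loses only a constant.
\<close>

lemma powr_le_truncation:
  fixes x l :: real
  assumes "0 \<le> x" "0 < l" "0 < p" "p \<le> real q"
  shows "x powr p \<le> l powr p + l powr (p - real q) * x ^ q"
proof (cases "x \<le> l")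
  case True
  then have "x powr p \<le> l powr p" using assms by (intro powr_mono2) auto
  moreover have "0 \<le> l powr (p - real q) * x ^ q" using assms by simp
  ultimately show ?thesis by linarith
next
  case False
  then have x: "0 < x" using assms by simp
  have "x powr p = x powr (p - real q) * x ^ q"
    using x by (simp add: powr_diff powr_realpow)
  also have "\<dots> \<le> l powr (p - real q) * x ^ q"
    using assms False by (intro mult_right_mono powr_mono2') auto
  finally show ?thesis by (simp add: add_increasing)
qed

text \<open>
  The main estimate: only the size \<open>L\<close> of the largest frequency matters. With \<open>L = 1\<close> it shows that all
  moments are finite, and with \<open>L = M\<close> it gives the rate of convergence.
\<close>

lemma cubic_norm_moment:
  fixes P :: "'a measure" and g :: "int \<Rightarrow> 'a \<Rightarrow> complex"
  assumes P: "prob_space P" and indep: "prob_space.indep_vars P (\<lambda>_. borel) g UNIV"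
    and gauss: "\<And>n. normalized_complex_gaussian P (g n)"
    and \<sigma>: "0 < \<sigma>" and p: "0 < p"
  obtains \<eta> C :: real where "0 < \<eta>" "0 < C"
    "\<And>B L. finite B \<Longrightarrow> B \<subseteq> unpaired_triples \<Longrightarrow> 1 \<le> L \<Longrightarrow>
      (\<And>a b d. (a, b, d) \<in> B \<Longrightarrow> L \<le> bracket (a - b + d) \<or> L \<le> bracket a \<or> L \<le> bracket b \<or> L \<le> bracket d) \<Longrightarrow>
      (\<integral>\<^sup>+u. ennreal (cubic_norm (- \<sigma>) B (fourier_coeff u) powr p) \<partial>gaussian_law P g) \<le> ennreal (C * L powr (- \<eta>))"
proof -
  interpret prob_space P by fact
  note [measurable] = normalized_complex_gaussian_measurable[OF gauss]
  define k where "k = nat \<lceil>p\<rceil>"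
  have pk: "p \<le> real (2 * Suc k)"
  proof -
    have "p \<le> real k" unfolding k_def by linarith
    then show ?thesis by simp
  qed
  define c where "c = (\<lambda>\<omega> n. g n \<omega> / complex_of_real (bracket n powr (1 / 2)))"
  define w where "w = (\<lambda>n::int. (1 + (real_of_int n)\<^sup>2) powr (- \<sigma>))"
  obtain K :: real where K: "K \<ge> 0" and mom:
    "\<And>B S w. finite B \<Longrightarrow> B \<subseteq> unpaired_triples \<Longrightarrow> finite S \<Longrightarrow> freq ` B \<subseteq> S \<Longrightarrow> (\<And>n. 0 \<le> w n) \<Longrightarrow>
      (\<integral>\<^sup>+\<omega>. ennreal ((\<Sum>n\<in>S. w n * (cmod (\<Sum>t\<in>{t \<in> B. freq t = n}. cubic_term (c \<omega>) t))\<^sup>2) ^ Suc k) \<partial>P)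
        \<le> ennreal ((K * (\<Sum>t\<in>B. w (freq t) * triple_weight t)) ^ Suc k)"
    using weighted_cubic_moment[OF P indep gauss, of k] unfolding c_def by blast
  obtain \<epsilon> D :: real where \<epsilon>: "0 < \<epsilon>" and D: "0 \<le> D" and decay:
    "\<And>B L. finite B \<Longrightarrow> 1 \<le> L \<Longrightarrow>
      (\<And>a b d. (a, b, d) \<in> B \<Longrightarrow> L \<le> bracket (a - b + d) \<or> L \<le> bracket a \<or> L \<le> bracket b \<or> L \<le> bracket d) \<Longrightarrow>
      (\<Sum>t\<in>B. w (freq t) * triple_weight t) \<le> D * L powr (- \<epsilon>)"
    using triple_sum_decay[OF \<sigma>] unfolding w_def by blast
  show ?thesis
  proof (rule that[of "\<epsilon> * p / 2" "1 + (K * D) ^ Suc k"])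
    show "0 < \<epsilon> * p / 2" using \<epsilon> p by simp
    show "0 < 1 + (K * D) ^ Suc k" using K D by (intro add_pos_nonneg) auto
    fix B :: "(int \<times> int \<times> int) set" and L :: real
    assume B: "finite B" "B \<subseteq> unpaired_triples" and L: "1 \<le> L" and large: "\<And>a b d. (a, b, d) \<in> B \<Longrightarrow>
      L \<le> bracket (a - b + d) \<or> L \<le> bracket a \<or> L \<le> bracket b \<or> L \<le> bracket d"
    define Y where "Y = (\<lambda>\<omega>. \<Sum>n\<in>freq ` B. w n * (cmod (\<Sum>t\<in>{t \<in> B. freq t = n}. cubic_term (c \<omega>) t))\<^sup>2)"
    have w0: "0 \<le> w n" for n by (simp add: w_def)
    have Y0: "0 \<le> Y \<omega>" for \<omega> unfolding Y_def using w0 by (intro sum_nonneg mult_nonneg_nonneg) auto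
    have norm_Y: "cubic_norm (- \<sigma>) B (c \<omega>) = sqrt (Y \<omega>)" for \<omega>
      by (simp add: cubic_norm_def Y_def w_def)
    have norm_Y_power: "cubic_norm (- \<sigma>) B (c \<omega>) ^ (2 * Suc k) = Y \<omega> ^ Suc k" for \<omega>
      unfolding norm_Y power_mult using Y0 by simp
    have measY [measurable]: "Y \<in> borel_measurable P"
    proof -
      have "(\<lambda>\<omega>. \<Sum>t\<in>{t \<in> B. freq t = n}. cubic_term (c \<omega>) t) \<in> borel_measurable P" for n
      proof -
        have [measurable]: "cnj \<in> borel_measurable borel"
          by (intro borel_measurable_continuous_onI continuous_on_cnj continuous_on_id)
        have [measurable]: "(\<lambda>\<omega>. c \<omega> m) \<in> borel_measurable P" for m unfolding c_def by measurable
        show ?thesis unfolding cubic_term_def split_beta by measurable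
      qed
      then show ?thesis unfolding Y_def by measurable
    qed
    \<comment> \<open>The size of the norm predicted by its moment of order \<open>2 (k + 1)\<close>.\<close>
    define l where "l = L powr (- \<epsilon> / 2)"
    have l: "0 < l" using L by (simp add: l_def)
    have lp: "l powr r = L powr (- \<epsilon> * r / 2)" for r by (simp add: l_def powr_powr)
    have "(\<integral>\<^sup>+u. ennreal (cubic_norm (- \<sigma>) B (fourier_coeff u) powr p) \<partial>gaussian_law P g)
       \<le> (\<integral>\<^sup>+\<omega>. ennreal (cubic_norm (- \<sigma>) B (fourier_coeff (random_series g \<omega>)) powr p) \<partial>P)"
      unfolding gaussian_law_def
    proof (rule nn_integral_distr_le)
      show "random_series g \<in> space P \<rightarrow> space (borel_of_topology X0_topology)"
        by (simp add: random_series_in_X0)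
      show "(\<lambda>u. ennreal (cubic_norm (- \<sigma>) B (fourier_coeff u) powr p)) \<in> borel_measurable (borel_of_topology X0_topology)"
        using borel_measurable_coeff_function[OF continuous_on_cubic_norm] by measurable
    qed
    also have "\<dots> \<le> (\<integral>\<^sup>+\<omega>. ennreal (l powr p) + ennreal (l powr (p - real (2 * Suc k))) * ennreal (Y \<omega> ^ Suc k) \<partial>P)"
    proof (intro nn_integral_mono)
      fix \<omega>
      have "cubic_norm (- \<sigma>) B (fourier_coeff (random_series g \<omega>)) powr p \<le> cubic_norm (- \<sigma>) B (c \<omega>) powr p"
        using fourier_coeff_random_series[of g \<omega>] cubic_norm_zero by (auto simp: c_def)
      also have "\<dots> \<le> l powr p + l powr (p - real (2 * Suc k)) * Y \<omega> ^ Suc k"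
        unfolding norm_Y_power[symmetric] using l p pk Y0 by (intro powr_le_truncation) (auto simp: norm_Y)
      finally have "ennreal (cubic_norm (- \<sigma>) B (fourier_coeff (random_series g \<omega>)) powr p)
         \<le> ennreal (l powr p + l powr (p - real (2 * Suc k)) * Y \<omega> ^ Suc k)" by (rule ennreal_leI)
      also have "\<dots> = ennreal (l powr p) + ennreal (l powr (p - real (2 * Suc k))) * ennreal (Y \<omega> ^ Suc k)"
        using Y0[of \<omega>] by (subst ennreal_plus) (auto intro!: mult_nonneg_nonneg simp del: power_Suc simp: ennreal_mult)
      finally show "ennreal (cubic_norm (- \<sigma>) B (fourier_coeff (random_series g \<omega>)) powr p)
         \<le> ennreal (l powr p) + ennreal (l powr (p - real (2 * Suc k))) * ennreal (Y \<omega> ^ Suc k)" .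
    qed
    also have "\<dots> = ennreal (l powr p) + ennreal (l powr (p - real (2 * Suc k))) * (\<integral>\<^sup>+\<omega>. ennreal (Y \<omega> ^ Suc k) \<partial>P)"
      by (subst nn_integral_add) (simp_all add: nn_integral_cmult emeasure_space_1 del: power_Suc)
    also have "\<dots> \<le> ennreal (l powr p) + ennreal (l powr (p - real (2 * Suc k))) * ennreal ((K * (D * L powr (- \<epsilon>))) ^ Suc k)"
    proof (intro add_left_mono mult_left_mono)
      have "(\<integral>\<^sup>+\<omega>. ennreal (Y \<omega> ^ Suc k) \<partial>P) \<le> ennreal ((K * (\<Sum>t\<in>B. w (freq t) * triple_weight t)) ^ Suc k)"
        unfolding Y_def by (intro mom B finite_imageI order_refl w0)
      also have "\<dots> \<le> ennreal ((K * (D * L powr (- \<epsilon>))) ^ Suc k)"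
        using K decay[OF B(1) L large] w0 triple_weight_nonneg
        by (intro ennreal_leI power_mono mult_left_mono mult_nonneg_nonneg sum_nonneg) auto
      finally show "(\<integral>\<^sup>+\<omega>. ennreal (Y \<omega> ^ Suc k) \<partial>P) \<le> ennreal ((K * (D * L powr (- \<epsilon>))) ^ Suc k)" .
    qed simp
    also have "\<dots> = ennreal (l powr p + l powr (p - real (2 * Suc k)) * (K * (D * L powr (- \<epsilon>))) ^ Suc k)"
      using K D by (subst ennreal_plus) (auto intro!: mult_nonneg_nonneg simp del: power_Suc simp: ennreal_mult)
    also have "l powr p + l powr (p - real (2 * Suc k)) * (K * (D * L powr (- \<epsilon>))) ^ Suc k
       = (1 + (K * D) ^ Suc k) * L powr (- (\<epsilon> * p / 2))"
    proof -
      have "(L powr (- \<epsilon>)) ^ Suc k = L powr (- \<epsilon> * real (Suc k))"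
        using L by (simp add: powr_powr flip: powr_realpow del: power_Suc)
      then have "l powr (p - real (2 * Suc k)) * (L powr (- \<epsilon>)) ^ Suc k
          = L powr (- \<epsilon> * (p - real (2 * Suc k)) / 2 + - \<epsilon> * real (Suc k))"
        by (simp only: lp powr_add)
      also have "- \<epsilon> * (p - real (2 * Suc k)) / 2 + - \<epsilon> * real (Suc k) = - (\<epsilon> * p / 2)"
        by (simp add: field_simps)
      finally have e: "l powr (p - real (2 * Suc k)) * (L powr (- \<epsilon>)) ^ Suc k = L powr (- (\<epsilon> * p / 2))" .
      have "(K * (D * L powr (- \<epsilon>))) ^ Suc k = (K * D) ^ Suc k * (L powr (- \<epsilon>)) ^ Suc k"
        by (simp only: power_mult_distrib mult.assoc)
      then have "l powr (p - real (2 * Suc k)) * (K * (D * L powr (- \<epsilon>))) ^ Suc k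
          = (K * D) ^ Suc k * L powr (- (\<epsilon> * p / 2))"
        unfolding e[symmetric] by (simp only: mult_ac)
      then show ?thesis by (simp add: lp distrib_right del: power_Suc)
    qed
    finally show "(\<integral>\<^sup>+u. ennreal (cubic_norm (- \<sigma>) B (fourier_coeff u) powr p) \<partial>gaussian_law P g)
        \<le> ennreal ((1 + (K * D) ^ Suc k) * L powr (- (\<epsilon> * p / 2)))" .
  qed
qed

lemma Lp_norm_le:
  assumes "(\<integral>\<^sup>+u. ennreal (sobolev_norm s (F u) powr p) \<partial>\<mu>) \<le> ennreal c" "0 \<le> c" "0 < p"
  shows "Lp_norm \<mu> p s F \<le> ennreal (c powr (1 / p))"
proof -
  have "(\<integral>\<^sup>+u. ennreal (sobolev_norm s (F u) powr p) \<partial>\<mu>) < \<top>"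
    using assms(1) by (rule le_less_trans) simp
  moreover have "enn2real (\<integral>\<^sup>+u. ennreal (sobolev_norm s (F u) powr p) \<partial>\<mu>) \<le> c"
    using assms by (intro enn2real_leI) auto
  ultimately show ?thesis
    unfolding Lp_norm_def Let_def using assms by (auto intro!: ennreal_leI powr_mono2)
qed

theorem proposition1p4:
  fixes P :: "'a measure" and g :: "int \<Rightarrow> 'a \<Rightarrow> complex" and \<sigma> :: real
  assumes "prob_space P"
    and "prob_space.indep_vars P (\<lambda>_. borel) g UNIV"
    and "\<And>n. normalized_complex_gaussian P (g n)"
    and "0 < \<sigma>"
  shows "\<forall>p::real. 2 \<le> p \<longrightarrow>
    Cauchy_in_Lp (gaussian_law P g) p (- \<sigma>) G \<and>
    (\<exists>\<eta> C :: real. 0 < \<eta> \<and> 0 < C \<and>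
      (\<forall>M N :: nat. 1 \<le> M \<and> M < N \<longrightarrow>
        (\<integral>\<^sup>+u. ennreal (sobolev_norm (- \<sigma>) (G N u - G M u) powr p) \<partial>gaussian_law P g)
          \<le> ennreal (C / real M powr \<eta>)))"
proof (intro allI impI)
  fix p :: real assume "2 \<le> p"
  then have p: "0 < p" by simp
  let ?I = "\<lambda>F. \<integral>\<^sup>+u. ennreal (sobolev_norm (- \<sigma>) (F u) powr p) \<partial>gaussian_law P g"
  obtain \<eta> C :: real where \<eta>: "0 < \<eta>" and C: "0 < C" and moment:
    "\<And>B L. finite B \<Longrightarrow> B \<subseteq> unpaired_triples \<Longrightarrow> 1 \<le> L \<Longrightarrow>
      (\<And>a b d. (a, b, d) \<in> B \<Longrightarrow> L \<le> bracket (a - b + d) \<or> L \<le> bracket a \<or> L \<le> bracket b \<or> L \<le> bracket d) \<Longrightarrow>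
      (\<integral>\<^sup>+u. ennreal (cubic_norm (- \<sigma>) B (fourier_coeff u) powr p) \<partial>gaussian_law P g) \<le> ennreal (C * L powr (- \<eta>))"
    using cubic_norm_moment[OF assms p] by blast
  have rate: "?I (\<lambda>u. G N u - G M u) \<le> ennreal (C / real M powr \<eta>)" if M: "1 \<le> M" "M < N" for M N
  proof -
    have "?I (\<lambda>u. G N u - G M u) \<le> ennreal (C * real M powr (- \<eta>))"
      unfolding sobolev_norm_G_diff[OF less_imp_le[OF M(2)]]
    proof (rule moment)
      fix a b d assume "(a, b, d) \<in> box N - box M"
      then have "int M < \<bar>a - b + d\<bar> \<or> int M < \<bar>a\<bar> \<or> int M < \<bar>b\<bar> \<or> int M < \<bar>d\<bar>"
        by (auto simp: box_def freq_def abs_le_iff not_less)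
      moreover have "real M \<le> bracket n" if "int M < \<bar>n\<bar>" for n
      proof -
        have "real_of_int (int M) < real_of_int \<bar>n\<bar>" using that by (simp only: of_int_less_iff)
        then show ?thesis by (simp add: bracket_def)
      qed
      ultimately show "real M \<le> bracket (a - b + d) \<or> real M \<le> bracket a \<or> real M \<le> bracket b \<or> real M \<le> bracket d"
        by blast
    qed (use M finite_box box_unpaired in auto)
    then show ?thesis by (simp add: powr_minus_divide)
  qed
  have finite_moment: "?I (G N) \<le> ennreal (C * 1 powr (- \<eta>))" for N
    unfolding sobolev_norm_G using bracket_ge_1 by (intro moment finite_box box_unpaired) auto
  have sym: "?I (\<lambda>u. G N u - G M u) = ?I (\<lambda>u. G M u - G N u)" for M N
    using sobolev_norm_diff_commute[of "- \<sigma>" "G N _" "G M _"] by simp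
  have "G N \<in> Lp_space (gaussian_law P g) p (- \<sigma>)" for N
  proof -
    have "G N \<in> gaussian_law P g \<rightarrow>\<^sub>M borel_of_topology (sobolev_topology (- \<sigma>))"
      unfolding gaussian_law_def using continuous_map_measurable[OF continuous_map_G] by simp
    moreover have "Lp_norm (gaussian_law P g) p (- \<sigma>) (G N) < \<top>"
      by (rule le_less_trans[OF Lp_norm_le[OF finite_moment]]) (use C p in auto)
    ultimately show ?thesis by (simp add: Lp_space_def)
  qed
  moreover have "\<exists>K\<ge>1. \<forall>M\<ge>K. \<forall>N\<ge>K. Lp_norm (gaussian_law P g) p (- \<sigma>) (\<lambda>u. G N u - G M u) < ennreal \<epsilon>"
    if \<epsilon>: "0 < \<epsilon>" for \<epsilon> :: real
  proof -
    have "((\<lambda>K. C * real K powr (- \<eta>)) \<longlongrightarrow> C * 0) sequentially"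
      using \<eta> by (intro tendsto_mult tendsto_const tendsto_neg_powr filterlim_real_sequentially) auto
    then have "\<forall>\<^sub>F K in sequentially. C * real K powr (- \<eta>) < \<epsilon> powr p"
      using \<epsilon> by (intro order_tendstoD(2)) auto
    then obtain K0 where "\<And>K. K \<ge> K0 \<Longrightarrow> C * real K powr (- \<eta>) < \<epsilon> powr p"
      by (auto simp: eventually_sequentially)
    then obtain K :: nat where K: "K \<ge> 1" "C * real K powr (- \<eta>) < \<epsilon> powr p"
      by (metis max.cobounded1 max.cobounded2)
    define \<delta> where "\<delta> = C * real K powr (- \<eta>)"
    have small: "?I (\<lambda>u. G N u - G M u) \<le> ennreal \<delta>" if "M \<ge> K" "M < N" for M N
    proof -
      have "?I (\<lambda>u. G N u - G M u) \<le> ennreal (C / real M powr \<eta>)" using K that by (intro rate) auto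
      also have "\<dots> = ennreal (C * real M powr (- \<eta>))" by (simp add: powr_minus_divide)
      also have "\<dots> \<le> ennreal \<delta>"
        unfolding \<delta>_def using C \<eta> K that by (intro ennreal_leI mult_left_mono powr_mono2') auto
      finally show ?thesis .
    qed
    have "Lp_norm (gaussian_law P g) p (- \<sigma>) (\<lambda>u. G N u - G M u) < ennreal \<epsilon>" if MN: "M \<ge> K" "N \<ge> K" for M N
    proof -
      have "?I (\<lambda>u. G N u - G M u) \<le> ennreal \<delta>"
      proof (cases M N rule: linorder_cases)
        case less then show ?thesis using small MN by blast
      next
        case equal then show ?thesis using p by simp
      next
        case greater then show ?thesis using small[of N M] MN sym[of N M] by simp
      qed
      then have "Lp_norm (gaussian_law P g) p (- \<sigma>) (\<lambda>u. G N u - G M u) \<le> ennreal (\<delta> powr (1 / p))"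
        by (rule Lp_norm_le) (use C p in \<open>auto simp: \<delta>_def\<close>)
      also have "\<dots> < ennreal \<epsilon>"
      proof (rule ennreal_lessI[OF \<epsilon>])
        have "\<delta> powr (1 / p) < (\<epsilon> powr p) powr (1 / p)"
          unfolding \<delta>_def using K C p by (intro powr_less_mono2) auto
        also have "\<dots> = \<epsilon>" using \<epsilon> p by (simp add: powr_powr)
        finally show "\<delta> powr (1 / p) < \<epsilon>" .
      qed
      finally show ?thesis .
    qed
    then show ?thesis using K(1) by blast
  qed
  ultimately have "Cauchy_in_Lp (gaussian_law P g) p (- \<sigma>) G"
    by (simp add: Cauchy_in_Lp_def)
  then show "Cauchy_in_Lp (gaussian_law P g) p (- \<sigma>) G \<and>
    (\<exists>\<eta> C :: real. 0 < \<eta> \<and> 0 < C \<and> (\<forall>M N :: nat. 1 \<le> M \<and> M < N \<longrightarrow>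
        ?I (\<lambda>u. G N u - G M u) \<le> ennreal (C / real M powr \<eta>)))"
    using \<eta> C rate by blast
qed

end
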